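(* Let $\Gamma$ be a connected metric graph and let $\mathrm{Real}(|K|)\subseteq|K|$ be the set of realizable canonical divisors. Then $\mathrm{Real}(|K|)$ is tropically convex.
   Context: Metric graph: the geometric realization of a finite graph with positive edge lengths; $\mathrm{val}(x)$ is the number of half-edges at $x$; a model has a finite vertex set $V$ whose complement is a disjoint union of open intervals (edges). All vertex weights are zero. A divisor is a finite formal sum $D=\sum_xD(x)\,x$, $D(x)\in\mathbb Z$; effective ($D\ge0$) if all $D(x)\ge0$. $K=\sum_x(\mathrm{val}(x)-2)\,x$. A rational function is a continuous piecewise linear $f:\Gamma\to\mathbb R$ with integer slopes; $\mathrm{ord}_x(f)$ is the sum of the outgoing slopes at $x$; $\mathrm{div}(f)=\sum_x\mathrm{ord}_x(f)\,x$. $R(K)$ is the set of rational $f$ with $K+\mathrm{div}(f)\ge0$ together with $-\infty$; $|K|=\{K+\mathrm{div}(f): f\in R(K)\setminus\{-\infty\}\}$. $R(K)$ is a tropical module under $f\oplus g=\max(f,g)$, $c\odot f=c+f$, and $|K|\cong(R(K)\setminus\{-\infty\})/\mathbb R$. A subset $Y\subseteq|K|$ is tropically convex if $\{f\in R(K):K+\mathrm{div}(f)\in Y\}\cup\{-\infty\}$ is a tropical submodule of $R(K)$ (closed under $\oplus$ and $\odot$). Realizability: an effective canonical divisor $D=K+\mathrm{div}(f)$ is realizable if $(\Gamma,D)$ arises as the tropicalization of a curve with an effective canonical divisor; by a theorem of Möller–Ulirsch–Werner this is equivalent to the following criterion, taken here as the definition. Use a model of $\Gamma$ whose vertex set contains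 $\{x:\mathrm{ord}_x(f)\ne0\}$. A vertex $v$ with outgoing slopes $s_1,\dots,s_r$ of $f$ along its adjacent edges is inconvenient if all $s_j\neq0$ and some $s_i<0$ satisfies $-s_i>\sum_{s_j>0}s_j$. An edge is horizontal if $f$ is constant on it. $D$ is realizable iff every inconvenient vertex $v$ is contained in a simple cycle $Z$ (closed path without self-intersection) with $f\ge f(v)$ on $Z$, and every horizontal edge $e$ is contained in a simple cycle $Z$ with $f\ge f(e)$ on $Z$. *)

theory Defs
  imports "HOL-Analysis.Analysis"
begin

section \<open>Metric graphs\<close>

text \<open>
  Loops, parallel edges and vertices of any valence are allowed. The orientation given by
  \<open>tail\<close> and \<open>head\<close> only serves to parametrise the edges.
\<close>

record ('v, 'e) graph =
  verts :: "'v set"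
  edges :: "'e set"
  tail :: "'e \<Rightarrow> 'v"
  head :: "'e \<Rightarrow> 'v"
  elen :: "'e \<Rightarrow> real"

definition metric_graph :: "('v, 'e) graph \<Rightarrow> bool" where
  "metric_graph G \<longleftrightarrow>
     finite (verts G) \<and> verts G \<noteq> {} \<and> finite (edges G) \<and>
     (\<forall>e\<in>edges G. tail G e \<in> verts G \<and> head G e \<in> verts G \<and> 0 < elen G e)"

datatype ('v, 'e) point = Vert 'v | Inner 'e real

definition points :: "('v, 'e) graph \<Rightarrow> ('v, 'e) point set" where
  "points G = Vert ` verts G \<union> {Inner e t |e t. e \<in> edges G \<and> 0 < t \<and> t < elen G e}"

text \<open>The characteristic map of the closed edge \<open>e\<close>, meaningful for \<open>t \<in> {0..elen G e}\<close>.\<close>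

definition chart :: "('v, 'e) graph \<Rightarrow> 'e \<Rightarrow> real \<Rightarrow> ('v, 'e) point" where
  "chart G e t =
     (if t = 0 then Vert (tail G e) else if t = elen G e then Vert (head G e) else Inner e t)"

text \<open>
  The geometric realization carries the quotient topology of the disjoint union of the vertices
  and the closed intervals \<open>{0..elen G e}\<close>, glued along the maps \<open>chart G e\<close>.
\<close>

definition realization :: "('v, 'e) graph \<Rightarrow> ('v, 'e) point topology" where
  "realization G = topology (\<lambda>U. U \<subseteq> points G \<and>
     (\<forall>e\<in>edges G. openin (top_of_set {0..elen G e}) {t \<in> {0..elen G e}. chart G e t \<in> U}))"

lemma openin_realization:
  "openin (realization G) U \<longleftrightarrow> U \<subseteq> points G \<and>
     (\<forall>e\<in>edges G. openin (top_of_set {0..elen G e}) {t \<in> {0..elen G e}. chart G e t \<in> U})"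
proof -
  let ?P = "\<lambda>e U. {t \<in> {0..elen G e}. chart G e t \<in> U}"
  have "istopology (\<lambda>U. U \<subseteq> points G \<and>
     (\<forall>e\<in>edges G. openin (top_of_set {0..elen G e}) (?P e U)))"
    unfolding istopology_def
  proof (intro conjI allI impI)
    fix S T
    assume "S \<subseteq> points G \<and> (\<forall>e\<in>edges G. openin (top_of_set {0..elen G e}) (?P e S))"
      and "T \<subseteq> points G \<and> (\<forall>e\<in>edges G. openin (top_of_set {0..elen G e}) (?P e T))"
    moreover have "?P e (S \<inter> T) = ?P e S \<inter> ?P e T" for e by auto
    ultimately show "S \<inter> T \<subseteq> points G"
      and "\<forall>e\<in>edges G. openin (top_of_set {0..elen G e}) (?P e (S \<inter> T))" by auto
  next
    fix \<U>
    assume *: "\<forall>U\<in>\<U>. U \<subseteq> points G \<and>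
      (\<forall>e\<in>edges G. openin (top_of_set {0..elen G e}) (?P e U))"
    then show "\<Union>\<U> \<subseteq> points G" by auto
    have "?P e (\<Union>\<U>) = \<Union>(?P e ` \<U>)" for e by auto
    moreover have "openin (top_of_set {0..elen G e}) (\<Union>(?P e ` \<U>))" if "e \<in> edges G" for e
      by (rule openin_Union) (use * that in auto)
    ultimately show "\<forall>e\<in>edges G. openin (top_of_set {0..elen G e}) (?P e (\<Union>\<U>))"
      by (intro ballI) (simp only:)
  qed
  then show ?thesis
    unfolding realization_def by (simp only: topology_inverse')
qed

lemma topspace_realization: "metric_graph G \<Longrightarrow> topspace (realization G) = points G"
proof
  show "topspace (realization G) \<subseteq> points G"
    using openin_realization openin_topspace by blast
  assume "metric_graph G"
  then have "{t \<in> {0..elen G e}. chart G e t \<in> points G} = {0..elen G e}" if "e \<in> edges G" for e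
    using that by (auto simp: metric_graph_def chart_def points_def)
  then have "openin (realization G) (points G)"
    by (simp add: openin_realization)
  then show "points G \<subseteq> topspace (realization G)"
    by (rule openin_subset)
qed

text \<open>
  The half-edges at \<open>x\<close>. In a triple \<open>(e, t, \<sigma>)\<close>, \<open>t\<close> is a parameter on \<open>e\<close> representing \<open>x\<close> and
  \<open>\<sigma>\<close> is the sign of the direction in which the parameter moves when leaving \<open>x\<close>. A loop
  contributes two half-edges at its base point; an inner point of an edge has two half-edges.
\<close>

definition half_edges :: "('v, 'e) graph \<Rightarrow> ('v, 'e) point \<Rightarrow> ('e \<times> real \<times> real) set" where
  "half_edges G x = {(e, t, \<sigma>). e \<in> edges G \<and> chart G e t = x \<and>
     (\<sigma> = 1 \<and> 0 \<le> t \<and> t < elen G e \<or> \<sigma> = -1 \<and> 0 < t \<and> t \<le> elen G e)}"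

definition val :: "('v, 'e) graph \<Rightarrow> ('v, 'e) point \<Rightarrow> nat" where
  "val G x = card (half_edges G x)"

text \<open>
  An edge of a model is a connected component of the complement of its vertex set. (The
  realization is locally connected, so the complement is the disjoint union of its components.)
\<close>

definition model_edges :: "('v, 'e) graph \<Rightarrow> ('v, 'e) point set \<Rightarrow> ('v, 'e) point set set" where
  "model_edges G V = connected_components_of (subtopology (realization G) (points G - V))"

definition model :: "('v, 'e) graph \<Rightarrow> ('v, 'e) point set \<Rightarrow> bool" where
  "model G V \<longleftrightarrow> finite V \<and> V \<subseteq> points G \<and>
     (\<forall>C\<in>model_edges G V.
        subtopology (realization G) C homeomorphic_space top_of_set {0<..<1::real})"

definition simple_cycle :: "('v, 'e) graph \<Rightarrow> ('v, 'e) point set \<Rightarrow> bool" where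
  "simple_cycle G Z \<longleftrightarrow>
     (\<exists>\<gamma>. pathin (realization G) \<gamma> \<and> \<gamma> 0 = \<gamma> 1 \<and> inj_on \<gamma> {0..<1} \<and> Z = \<gamma> ` {0..1})"


section \<open>Divisors and rational functions\<close>

text \<open>
  Functions on the metric graph are total functions on the type of points; values outside
  \<open>points G\<close> are irrelevant. Divisors vanish outside \<open>points G\<close>.
\<close>

definition divisor :: "('v, 'e) graph \<Rightarrow> (('v, 'e) point \<Rightarrow> int) \<Rightarrow> bool" where
  "divisor G D \<longleftrightarrow> finite {x. D x \<noteq> 0} \<and> {x. D x \<noteq> 0} \<subseteq> points G"

definition effective :: "('v, 'e) graph \<Rightarrow> (('v, 'e) point \<Rightarrow> int) \<Rightarrow> bool" where
  "effective G D \<longleftrightarrow> divisor G D \<and> (\<forall>x. 0 \<le> D x)"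

definition canonical_divisor :: "('v, 'e) graph \<Rightarrow> ('v, 'e) point \<Rightarrow> int" where
  "canonical_divisor G x = (if x \<in> points G then int (val G x) - 2 else 0)"

definition rational_function :: "('v, 'e) graph \<Rightarrow> (('v, 'e) point \<Rightarrow> real) \<Rightarrow> bool" where
  "rational_function G f \<longleftrightarrow>
     continuous_map (realization G) euclideanreal f \<and>
     (\<forall>e\<in>edges G. \<exists>S. finite S \<and>
        (\<forall>a b. 0 \<le> a \<and> a < b \<and> b \<le> elen G e \<and> {a<..<b} \<inter> S = {} \<longrightarrow>
           (\<exists>(k::int) c. \<forall>t\<in>{a<..<b}. f (chart G e t) = of_int k * t + c)))"

text \<open>The description \<open>THE k\<close> is well defined when \<open>f\<close> is rational and the triple is a half-edge.\<close>

fun slope ::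
    "('v, 'e) graph \<Rightarrow> (('v, 'e) point \<Rightarrow> real) \<Rightarrow> 'e \<times> real \<times> real \<Rightarrow> int" where
  "slope G f (e, t, \<sigma>) =
     (THE k. \<exists>\<delta>>0. \<forall>h\<in>{0<..<\<delta>}. f (chart G e (t + \<sigma> * h)) = f (chart G e t) + of_int k * h)"

definition ord_at ::
    "('v, 'e) graph \<Rightarrow> (('v, 'e) point \<Rightarrow> real) \<Rightarrow> ('v, 'e) point \<Rightarrow> int" where
  "ord_at G f x = (\<Sum>d\<in>half_edges G x. slope G f d)"

definition div_of ::
    "('v, 'e) graph \<Rightarrow> (('v, 'e) point \<Rightarrow> real) \<Rightarrow> ('v, 'e) point \<Rightarrow> int" where
  "div_of G f x = (if x \<in> points G then ord_at G f x else 0)"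

definition K_plus_div ::
    "('v, 'e) graph \<Rightarrow> (('v, 'e) point \<Rightarrow> real) \<Rightarrow> ('v, 'e) point \<Rightarrow> int" where
  "K_plus_div G f = (\<lambda>x. canonical_divisor G x + div_of G f x)"

definition canonical_functions :: "('v, 'e) graph \<Rightarrow> (('v, 'e) point \<Rightarrow> real) set" where
  "canonical_functions G = {f. rational_function G f \<and> effective G (K_plus_div G f)}"

definition canonical_system :: "('v, 'e) graph \<Rightarrow> (('v, 'e) point \<Rightarrow> int) set" where
  "canonical_system G = K_plus_div G ` canonical_functions G"


section \<open>Tropical modules\<close>

text \<open>
  Elements of tropical modules are functions with values in \<open>ereal\<close>; the element \<open>-\<infinity>\<close> is the
  constant function, and real-valued functions are embedded pointwise.
\<close>

definition lift_fun :: "('a \<Rightarrow> real) \<Rightarrow> 'a \<Rightarrow> ereal" where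
  "lift_fun f = (\<lambda>x. ereal (f x))"

definition trop_bot :: "'a \<Rightarrow> ereal" where
  "trop_bot = (\<lambda>x. -\<infinity>)"

definition trop_add :: "('a \<Rightarrow> ereal) \<Rightarrow> ('a \<Rightarrow> ereal) \<Rightarrow> 'a \<Rightarrow> ereal" where
  "trop_add f g = (\<lambda>x. max (f x) (g x))"

definition trop_scale :: "ereal \<Rightarrow> ('a \<Rightarrow> ereal) \<Rightarrow> 'a \<Rightarrow> ereal" where
  "trop_scale c f = (\<lambda>x. c + f x)"

definition RK :: "('v, 'e) graph \<Rightarrow> (('v, 'e) point \<Rightarrow> ereal) set" where
  "RK G = insert trop_bot (lift_fun ` canonical_functions G)"

text \<open>Scalars range over the tropical semifield, the reals together with \<open>-\<infinity>\<close>.\<close>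

definition trop_submodule :: "('a \<Rightarrow> ereal) set \<Rightarrow> ('a \<Rightarrow> ereal) set \<Rightarrow> bool" where
  "trop_submodule M R \<longleftrightarrow> M \<subseteq> R \<and> trop_bot \<in> M \<and>
     (\<forall>f\<in>M. \<forall>g\<in>M. trop_add f g \<in> M) \<and>
     (\<forall>c f. c \<noteq> \<infinity> \<longrightarrow> f \<in> M \<longrightarrow> trop_scale c f \<in> M)"

definition tropically_convex ::
    "('v, 'e) graph \<Rightarrow> (('v, 'e) point \<Rightarrow> int) set \<Rightarrow> bool" where
  "tropically_convex G Y \<longleftrightarrow> Y \<subseteq> canonical_system G \<and>
     trop_submodule
       (insert trop_bot (lift_fun ` {f \<in> canonical_functions G. K_plus_div G f \<in> Y})) (RK G)"


section \<open>Realizability\<close>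

definition inconvenient ::
    "('v, 'e) graph \<Rightarrow> (('v, 'e) point \<Rightarrow> real) \<Rightarrow> ('v, 'e) point \<Rightarrow> bool" where
  "inconvenient G f v \<longleftrightarrow>
     (\<forall>d\<in>half_edges G v. slope G f d \<noteq> 0) \<and>
     (\<exists>d\<in>half_edges G v. slope G f d < 0 \<and>
        - slope G f d > (\<Sum>d' | d' \<in> half_edges G v \<and> slope G f d' > 0. slope G f d'))"

definition horizontal :: "(('v, 'e) point \<Rightarrow> real) \<Rightarrow> ('v, 'e) point set \<Rightarrow> bool" where
  "horizontal f e \<longleftrightarrow> f constant_on e"

text \<open>The criterion of Moeller, Ulirsch and Werner, relative to the vertex set \<open>V\<close> of a model.\<close>

definition realizability_criterion ::
    "('v, 'e) graph \<Rightarrow> ('v, 'e) point set \<Rightarrow> (('v, 'e) point \<Rightarrow> real) \<Rightarrow> bool" where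
  "realizability_criterion G V f \<longleftrightarrow>
     (\<forall>v\<in>V. inconvenient G f v \<longrightarrow>
        (\<exists>Z. simple_cycle G Z \<and> v \<in> Z \<and> (\<forall>z\<in>Z. f z \<ge> f v))) \<and>
     (\<forall>e\<in>model_edges G V. horizontal f e \<longrightarrow>
        (\<exists>Z. simple_cycle G Z \<and> e \<subseteq> Z \<and> (\<forall>z\<in>Z. \<forall>x\<in>e. f z \<ge> f x)))"

text \<open>
  On a connected metric graph \<open>f\<close> is determined by its divisor up to an additive constant, and
  the criterion depends neither on that constant nor on the choice of the model.
\<close>

definition realizable :: "('v, 'e) graph \<Rightarrow> (('v, 'e) point \<Rightarrow> int) \<Rightarrow> bool" where
  "realizable G D \<longleftrightarrow>
     (\<exists>f\<in>canonical_functions G. D = K_plus_div G f \<and>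
        (\<exists>V. model G V \<and> {x \<in> points G. ord_at G f x \<noteq> 0} \<subseteq> V \<and>
             realizability_criterion G V f))"

definition realizable_divisors :: "('v, 'e) graph \<Rightarrow> (('v, 'e) point \<Rightarrow> int) set" where
  "realizable_divisors G = {D \<in> canonical_system G. realizable G D}"

end

theory Submission
  imports Defs
begin

text \<open>
  Let \<open>h = max f g\<close>. At a point where \<open>f = h\<close>, the inequality \<open>f \<le> h\<close> makes every outgoing slope
  of \<open>f\<close> at most the corresponding slope of \<open>h\<close>. So if \<open>v\<close> is inconvenient for \<open>h\<close>, then either it is
  inconvenient for \<open>f\<close>, or \<open>f\<close> has a vanishing slope at \<open>v\<close>, hence a horizontal edge with endpoint
  \<open>v\<close>. If \<open>h\<close> is constant on an edge on which \<open>f\<close> is harmonic, the slopes of \<open>f\<close> at a point with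
  \<open>f = h\<close> are nonpositive with sum zero, so \<open>f\<close> is constant on that edge as well. In each case a
  cycle for \<open>f\<close> is also a cycle for \<open>h\<close>, because \<open>h \<ge> f\<close>.
\<close>

subsection \<open>Half-edges and the topology of the realization\<close>

text \<open>The definitions are topological: a model edge is a component of a complement that is
  homeomorphic to an open interval, and it may run through two-valent vertices of \<open>G\<close>
  and over several of its edges. The arguments about slopes therefore never parametrise a model
  edge. Everything is localised at half-edges: for small \<open>h\<close>, \<open>leg G d h\<close>
  is the point at distance \<open>h\<close> from the base point of \<open>d\<close>, and openness in
  the realization becomes a condition on legs. Connectedness of a model edge then spreads a
  vanishing slope over all of it, because no point of it has three half-edges. Two further points
  shape the proof. Realizability of a divisor asks for some function and some model, so a given
  function with the same divisor must inherit the criterion; on a connected graph the two functions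
  differ by a constant. And the maximum needs a model of its own, finer than those of
  \<open>f\<close> and \<open>g\<close>: its edges lie in edges of the old models, and a cycle
  containing the larger edge also contains the smaller one.\<close>

fun leg :: "('v, 'e) graph \<Rightarrow> 'e \<times> real \<times> real \<Rightarrow> real \<Rightarrow> ('v, 'e) point" where
  "leg G (e, t, \<sigma>) h = chart G e (t + \<sigma> * h)"

lemma metric_graph_elen: "metric_graph G \<Longrightarrow> e \<in> edges G \<Longrightarrow> 0 < elen G e"
  by (auto simp: metric_graph_def)

lemma chart_inner: "0 < t \<Longrightarrow> t < elen G e \<Longrightarrow> chart G e t = Inner e t"
  by (simp add: chart_def)

lemma chart_in_points:
  "metric_graph G \<Longrightarrow> e \<in> edges G \<Longrightarrow> 0 \<le> t \<Longrightarrow> t \<le> elen G e \<Longrightarrow> chart G e t \<in> points G"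
  by (auto simp: metric_graph_def chart_def points_def)

lemma half_edges_Inner:
  assumes "e \<in> edges G" "0 < t" "t < elen G e"
  shows "half_edges G (Inner e t) = {(e, t, 1), (e, t, -1)}"
  using assms by (auto simp: half_edges_def chart_def split: if_splits)

lemma half_edges_Vert:
  "half_edges G (Vert v) \<subseteq> (\<lambda>e. (e, 0, 1)) ` edges G \<union> (\<lambda>e. (e, elen G e, -1)) ` edges G"
  by (auto simp: half_edges_def chart_def split: if_splits)

lemma finite_half_edges:
  assumes "metric_graph G"
  shows "finite (half_edges G x)"
proof (cases x)
  case (Vert v)
  have "finite ((\<lambda>e. (e, 0, 1)) ` edges G \<union> (\<lambda>e. (e, elen G e, -1)) ` edges G)"
    using assms by (auto simp: metric_graph_def)
  then show ?thesis
    unfolding Vert by (rule finite_subset[OF half_edges_Vert])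
next
  case (Inner e t)
  have "half_edges G x \<subseteq> {(e, t, 1), (e, t, -1)}"
    unfolding Inner by (auto simp: half_edges_def chart_def split: if_splits)
  then show ?thesis
    by (rule finite_subset) simp
qed

section \<open>Legs of half-edges and the local description of open sets\<close>

lemma leg_0: "d \<in> half_edges G x \<Longrightarrow> leg G d 0 = x"
  by (auto simp: half_edges_def)

text \<open>Away from its base point a leg runs through points \<open>Inner e s\<close>, which
  determine their edge and parameter; vertices do not, so comparisons of legs are made here.\<close>

lemma eventually_leg_Inner:
  assumes "(e, t, \<sigma>) \<in> half_edges G x"
  shows "\<forall>\<^sub>F h in at_right 0. 0 < h \<and> 0 < t + \<sigma> * h \<and> t + \<sigma> * h < elen G e \<and>
    leg G (e, t, \<sigma>) h = Inner e (t + \<sigma> * h)"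
proof -
  have "\<exists>b>0. \<forall>h>0. h < b \<longrightarrow> 0 < t + \<sigma> * h \<and> t + \<sigma> * h < elen G e"
  proof (cases "\<sigma> = 1")
    case True
    with assms show ?thesis
      by (intro exI[of _ "elen G e - t"]) (auto simp: half_edges_def)
  next
    case False
    with assms show ?thesis
      by (intro exI[of _ t]) (auto simp: half_edges_def)
  qed
  then obtain b where "b > 0" "\<And>h. h > 0 \<Longrightarrow> h < b \<Longrightarrow> 0 < t + \<sigma> * h \<and> t + \<sigma> * h < elen G e"
    by blast
  then show ?thesis
    unfolding eventually_at_right_field by (intro exI[of _ b]) (simp add: chart_inner)
qed

text \<open>In a closed interval, a neighbourhood of a parameter is given by two one-sided
  conditions, and each of them belongs to a half-edge. Open sets of the realization are produced and
  exploited below mostly in this form.\<close>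

lemma openin_realization_iff:
  assumes G: "metric_graph G"
  shows "openin (realization G) U \<longleftrightarrow> U \<subseteq> points G \<and>
    (\<forall>x\<in>U. \<forall>d\<in>half_edges G x. \<forall>\<^sub>F h in at_right 0. leg G d h \<in> U)"
  (is "_ \<longleftrightarrow> _ \<and> ?R")
proof (intro iffI conjI)
  assume U: "openin (realization G) U"
  then show "U \<subseteq> points G"
    by (simp add: openin_realization)
  show ?R
  proof (intro ballI)
    fix x d assume x: "x \<in> U" and d: "d \<in> half_edges G x"
    obtain e t \<sigma> where dd: "d = (e, t, \<sigma>)"
      by (cases d)
    have e: "e \<in> edges G" and xt: "chart G e t = x" and s: "\<sigma> = 1 \<or> \<sigma> = -1"
      and t: "0 \<le> t" "t \<le> elen G e"
      using d dd by (auto simp: half_edges_def)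
    define P where "P = {t \<in> {0..elen G e}. chart G e t \<in> U}"
    have "openin (top_of_set {0..elen G e}) P"
      using U e by (simp add: openin_realization P_def)
    moreover have "t \<in> P"
      using t x xt by (simp add: P_def)
    ultimately obtain \<epsilon> where \<epsilon>: "\<epsilon> > 0" "ball t \<epsilon> \<inter> {0..elen G e} \<subseteq> P"
      unfolding openin_contains_ball by blast
    have "\<forall>\<^sub>F h in at_right 0. h < \<epsilon>"
      unfolding eventually_at_right_field using \<epsilon> by blast
    then show "\<forall>\<^sub>F h in at_right 0. leg G d h \<in> U"
      using eventually_leg_Inner[OF d[unfolded dd]]
    proof eventually_elim
      case (elim h)
      then have "t + \<sigma> * h \<in> ball t \<epsilon> \<inter> {0..elen G e}"
        using s by (auto simp: dist_real_def)
      then show ?case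
        using \<epsilon>(2) by (auto simp: dd P_def)
    qed
  qed
next
  assume *: "U \<subseteq> points G \<and> ?R"
  have "openin (top_of_set {0..elen G e}) {t \<in> {0..elen G e}. chart G e t \<in> U}"
    if e: "e \<in> edges G" for e
    unfolding openin_contains_ball
  proof (intro conjI ballI)
    fix t assume t: "t \<in> {t \<in> {0..elen G e}. chart G e t \<in> U}"
    have "\<exists>b>0. \<forall>h>0. h < b \<and> t + \<sigma> * h \<in> {0..elen G e} \<longrightarrow> chart G e (t + \<sigma> * h) \<in> U"
      if \<sigma>: "\<sigma> = 1 \<or> \<sigma> = -1" for \<sigma>
    proof (cases "(e, t, \<sigma>) \<in> half_edges G (chart G e t)")
      case True
      then have "\<forall>\<^sub>F h in at_right 0. leg G (e, t, \<sigma>) h \<in> U"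
        using * t by blast
      then show ?thesis
        unfolding eventually_at_right_field by auto
    next
      \<comment> \<open>The parameter \<open>t\<close> is the end of the edge in direction \<sigma>,
        so \<open>t + \<sigma> * h\<close> leaves the interval and the claim is vacuous.\<close>
      case False
      then show ?thesis
        using \<sigma> t e by (intro exI[of _ 1]) (auto simp: half_edges_def)
    qed
    from this[of 1] this[of "-1"] obtain b c where b: "b > 0" "c > 0"
      "\<And>h. h > 0 \<Longrightarrow> h < b \<Longrightarrow> t + h \<in> {0..elen G e} \<Longrightarrow> chart G e (t + h) \<in> U"
      "\<And>h. h > 0 \<Longrightarrow> h < c \<Longrightarrow> t - h \<in> {0..elen G e} \<Longrightarrow> chart G e (t - h) \<in> U"
      by auto
    have "ball t (min b c) \<inter> {0..elen G e} \<subseteq> {t \<in> {0..elen G e}. chart G e t \<in> U}"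
    proof
      fix s assume s: "s \<in> ball t (min b c) \<inter> {0..elen G e}"
      consider "s = t" | "s < t" | "s > t" by linarith
      then show "s \<in> {t \<in> {0..elen G e}. chart G e t \<in> U}"
        using s t b(3)[of "s - t"] b(4)[of "t - s"] by cases (auto simp: dist_real_def)
    qed
    then show "\<exists>\<epsilon>>0. ball t \<epsilon> \<inter> {0..elen G e} \<subseteq> {t \<in> {0..elen G e}. chart G e t \<in> U}"
      using b by (intro exI[of _ "min b c"]) auto
  qed auto
  with * show "openin (realization G) U"
    by (auto simp: openin_realization)
qed

lemma continuous_map_chart:
  assumes "metric_graph G" "e \<in> edges G"
  shows "continuous_map (top_of_set {0..elen G e}) (realization G) (chart G e)"
  using assms chart_in_points[OF assms]
  by (auto simp: continuous_map_def openin_realization topspace_realization)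

lemma continuous_map_realizationI:
  fixes f :: "('v, 'e) point \<Rightarrow> real"
  assumes "metric_graph G" "\<And>e. e \<in> edges G \<Longrightarrow> continuous_on {0..elen G e} (\<lambda>t. f (chart G e t))"
  shows "continuous_map (realization G) euclideanreal f"
proof -
  have "openin (realization G) {x \<in> points G. f x \<in> U}" if U: "open U" for U
    unfolding openin_realization
  proof (intro conjI ballI)
    fix e assume e: "e \<in> edges G"
    have "{t \<in> {0..elen G e}. chart G e t \<in> {x \<in> points G. f x \<in> U}} =
        {0..elen G e} \<inter> (\<lambda>t. f (chart G e t)) -` U"
      using chart_in_points[OF assms(1) e] by auto
    then show "openin (top_of_set {0..elen G e})
        {t \<in> {0..elen G e}. chart G e t \<in> {x \<in> points G. f x \<in> U}}"
      using continuous_openin_preimage_gen[OF assms(2)[OF e] U] by simp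
  qed auto
  then show ?thesis
    by (simp add: continuous_map_def topspace_realization[OF assms(1)])
qed

lemma finite_chart_preimage:
  assumes "finite V"
  shows "finite {t \<in> {0..elen G e}. chart G e t \<in> V}"
proof -
  have "{t \<in> {0..elen G e}. chart G e t \<in> V} \<subseteq> insert 0 (insert (elen G e) (Inner e -` V))"
    by (auto simp: chart_def split: if_splits)
  moreover have "finite (Inner e -` V)"
    using assms by (intro finite_vimageI) (auto simp: inj_on_def)
  ultimately show ?thesis
    by (meson finite_insert finite_subset)
qed

lemma eventually_avoid_finite:
  fixes S :: "real set"
  assumes "finite S" "\<sigma> = 1 \<or> \<sigma> = -1"
  shows "\<forall>\<^sub>F h in at_right 0. t + \<sigma> * h \<notin> S"
proof -
  \<comment> \<open>\<open>t\<close> itself may lie in \<open>S\<close>; only the distances to the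
    other elements bound the step.\<close>
  let ?A = "(\<lambda>s. \<bar>s - t\<bar>) ` (S - {t})"
  have "\<exists>b>0. \<forall>a\<in>?A. b \<le> a"
  proof (cases "?A = {}")
    case False
    then have "Min ?A \<in> ?A"
      using assms(1) by (intro Min_in) auto
    then have "Min ?A > 0"
      by auto
    then show ?thesis
      using assms(1) by (intro exI[of _ "Min ?A"]) auto
  qed (auto intro: exI[of _ 1])
  then obtain b where b: "b > 0" "\<And>s. s \<in> S \<Longrightarrow> s \<noteq> t \<Longrightarrow> b \<le> \<bar>s - t\<bar>"
    by auto
  show ?thesis
    unfolding eventually_at_right_field
  proof (intro exI[of _ b] conjI allI impI b(1))
    fix h :: real assume "0 < h" "h < b"
    then show "t + \<sigma> * h \<notin> S"
      using b(2)[of "t + \<sigma> * h"] assms(2) by auto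
  qed
qed

text \<open>With \<open>V\<close> empty this says that legs run inside \<open>points G\<close>, the
  form used to carry an inequality known on \<open>points G\<close> to a leg.\<close>

lemma eventually_leg_avoid:
  assumes "metric_graph G" "finite V" "d \<in> half_edges G x"
  shows "\<forall>\<^sub>F h in at_right 0. leg G d h \<in> points G - V"
proof -
  obtain e t \<sigma> where d: "d = (e, t, \<sigma>)"
    by (cases d)
  have e: "e \<in> edges G" and s: "\<sigma> = 1 \<or> \<sigma> = -1"
    using assms d by (auto simp: half_edges_def)
  show ?thesis
    using eventually_leg_Inner[OF assms(3)[unfolded d]]
      eventually_avoid_finite[OF finite_chart_preimage[OF assms(2), of G e] s, of t]
    by eventually_elim (use e in \<open>auto simp: d points_def\<close>)
qed

lemma continuous_map_leg:
  assumes "metric_graph G" "d \<in> half_edges G x"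
  shows "\<exists>\<delta>>0. continuous_map (top_of_set {0..\<delta>}) (realization G) (leg G d)"
proof -
  obtain e t \<sigma> where d: "d = (e, t, \<sigma>)"
    by (cases d)
  have e: "e \<in> edges G" and t: "t \<in> {0..elen G e}"
    using assms d by (auto simp: half_edges_def)
  have "\<forall>\<^sub>F h in at_right 0. t + \<sigma> * h \<in> {0..elen G e}"
    using eventually_leg_Inner[OF assms(2)[unfolded d]] by eventually_elim auto
  then obtain b where b: "b > 0" "\<And>h. 0 < h \<Longrightarrow> h < b \<Longrightarrow> t + \<sigma> * h \<in> {0..elen G e}"
    unfolding eventually_at_right_field by blast
  have "t + \<sigma> * h \<in> {0..elen G e}" if "h \<in> {0..b/2}" for h
    using b(2)[of h] t that b(1) by (cases "h = 0") auto
  then have "continuous_map (top_of_set {0..b/2}) (top_of_set {0..elen G e}) (\<lambda>h. t + \<sigma> * h)"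
    by (auto intro!: continuous_intros)
  from continuous_map_compose[OF this continuous_map_chart[OF assms(1) e]]
  moreover have "leg G d = (\<lambda>h. chart G e (t + \<sigma> * h))"
    by (simp add: d fun_eq_iff)
  ultimately show ?thesis
    using b(1) by (intro exI[of _ "b/2"]) (simp add: o_def)
qed

text \<open>A punctured initial piece of a leg is connected and avoids the finite set
  \<open>V\<close>, so one component contains it, even when \<open>x\<close> belongs to
  \<open>V\<close>. If \<open>x\<close> lies in a component, the piece stays connected when
  \<open>x\<close> is added, and that component is the one of \<open>x\<close>.\<close>

lemma leg_in_component:
  assumes G: "metric_graph G" and "finite V" "d \<in> half_edges G x" "x \<in> points G"
  shows "\<exists>C\<in>model_edges G V. \<forall>\<^sub>F h in at_right 0. leg G d h \<in> C"
    and "C \<in> model_edges G V \<Longrightarrow> x \<in> C \<Longrightarrow> \<forall>\<^sub>F h in at_right 0. leg G d h \<in> C"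
proof -
  let ?X = "subtopology (realization G) (points G - V)"
  obtain \<delta> where \<delta>: "\<delta> > 0" "continuous_map (top_of_set {0..\<delta>}) (realization G) (leg G d)"
    using continuous_map_leg[OF G assms(3)] by blast
  obtain b where b: "b > 0" "\<And>h. 0 < h \<Longrightarrow> h < b \<Longrightarrow> leg G d h \<in> points G - V"
    using eventually_leg_avoid[OF assms(1-3)] unfolding eventually_at_right_field by blast
  define c where "c = min b \<delta>"
  have conn: "connectedin ?X (leg G d ` J)"
    if "J \<subseteq> {0..<c}" "connected J" "leg G d ` J \<subseteq> points G - V" for J
  proof -
    have "connectedin (top_of_set {0..\<delta>}) J"
      using that by (auto simp: connectedin_subtopology c_def)
    then show ?thesis
      using that connectedin_continuous_map_image[OF \<delta>(2)]
      by (auto simp: connectedin_subtopology)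
  qed
  have ev: "\<forall>\<^sub>F h in at_right 0. leg G d h \<in> C" if "leg G d ` {0<..<c} \<subseteq> C" for C
    unfolding eventually_at_right_field using that \<delta>(1) b(1) by (intro exI[of _ c]) (auto simp: c_def)
  have 1: "connectedin ?X (leg G d ` {0<..<c})"
    by (rule conn) (use b in \<open>auto simp: c_def\<close>)
  have ne: "leg G d ` {0<..<c} \<noteq> {}"
    using \<delta>(1) b(1) by (auto simp: c_def)
  have X: "?X \<noteq> trivial_topology"
    using connectedin_subset_topspace[OF 1] ne
    by (metis subset_empty topspace_discrete_topology)
  then obtain D where "D \<in> connected_components_of ?X" "leg G d ` {0<..<c} \<subseteq> D"
    using exists_connected_component_of_superset[OF 1 X] by blast
  then show "\<exists>C\<in>model_edges G V. \<forall>\<^sub>F h in at_right 0. leg G d h \<in> C"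
    using ev unfolding model_edges_def by blast
  assume C: "C \<in> model_edges G V" "x \<in> C"
  have xV: "x \<in> points G - V"
    using connected_components_of_subset[OF C(1)[unfolded model_edges_def]] C(2)
    by (auto simp: topspace_realization[OF G])
  have 2: "connectedin ?X (leg G d ` {0..<c})"
  proof (rule conn)
    show "leg G d ` {0..<c} \<subseteq> points G - V"
    proof
      fix y assume "y \<in> leg G d ` {0..<c}"
      then obtain h where "y = leg G d h" "0 \<le> h" "h < b" by (auto simp: c_def)
      then show "y \<in> points G - V"
        using b(2)[of h] xV leg_0[OF assms(3)] by (cases "h = 0") auto
    qed
  qed auto
  have "x \<in> leg G d ` {0..<c}"
    using leg_0[OF assms(3)] \<delta>(1) b(1) by (force simp: c_def)
  then have "leg G d ` {0..<c} \<subseteq> C"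
    using connected_components_of_maximal[OF C(1)[unfolded model_edges_def] 2] C(2)
    by (auto simp: disjnt_iff)
  then show "\<forall>\<^sub>F h in at_right 0. leg G d h \<in> C"
    by (intro ev) (meson atLeastLessThan_iff greaterThanLessThan_iff image_mono less_imp_le order_trans subsetI)
qed

subsection \<open>Slopes of rational functions\<close>

declare slope.simps [simp del]

lemma slope_eqI:
  assumes "d \<in> half_edges G x"
    and "\<forall>\<^sub>F h in at_right 0. f (leg G d h) = f x + of_int k * h"
  shows "slope G f d = k"
proof -
  obtain e t \<sigma> where d: "d = (e, t, \<sigma>)"
    by (cases d)
  have x: "chart G e t = x"
    using assms(1) d by (auto simp: half_edges_def)
  obtain b where b: "b > 0" "\<And>h. 0 < h \<Longrightarrow> h < b \<Longrightarrow> f (chart G e (t + \<sigma> * h)) = f x + of_int k * h"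
    using assms(2) unfolding eventually_at_right_field d by auto
  show ?thesis
    unfolding d slope.simps x
  proof (rule the_equality)
    show "\<exists>\<delta>>0. \<forall>h\<in>{0<..<\<delta>}. f (chart G e (t + \<sigma> * h)) = f x + of_int k * h"
      using b by auto
    fix k' :: int
    assume "\<exists>\<delta>>0. \<forall>h\<in>{0<..<\<delta>}. f (chart G e (t + \<sigma> * h)) = f x + of_int k' * h"
    then obtain c where c: "c > 0"
        "\<forall>h\<in>{0<..<c}. f (chart G e (t + \<sigma> * h)) = f x + of_int k' * h"
      by blast
    define h where "h = min b c / 2"
    have "0 < h" "h < b" "h < c"
      using b c by (auto simp: h_def)
    then show "k' = k"
      using b(2)[of h] c(2) by auto
  qed
qed

lemma rational_functionE:
  assumes "rational_function G f" "e \<in> edges G"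
  obtains S where "finite S" "\<And>a b. 0 \<le> a \<Longrightarrow> a < b \<Longrightarrow> b \<le> elen G e \<Longrightarrow> {a<..<b} \<inter> S = {} \<Longrightarrow>
      \<exists>(k::int) c. \<forall>t\<in>{a<..<b}. f (chart G e t) = of_int k * t + c"
  using assms unfolding rational_function_def by metis

text \<open>Piecewise linearity is demanded on open intervals only, so the value at \<open>x\<close>
  comes from continuity: along the leg, \<open>f\<close> and its affine formula have the same
  limit.\<close>

lemma eventually_slope:
  assumes G: "metric_graph G" and f: "rational_function G f" and d: "d \<in> half_edges G x"
  shows "\<forall>\<^sub>F h in at_right 0. f (leg G d h) = f x + of_int (slope G f d) * h"
proof -
  obtain e t \<sigma> where dd: "d = (e, t, \<sigma>)"
    by (cases d)
  have e: "e \<in> edges G" and xt: "chart G e t = x" and s: "\<sigma> = 1 \<or> \<sigma> = -1"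
    and t: "t \<in> {0..elen G e}"
    using d dd by (auto simp: half_edges_def)
  obtain S where S: "finite S" "\<And>a b. 0 \<le> a \<Longrightarrow> a < b \<Longrightarrow> b \<le> elen G e \<Longrightarrow> {a<..<b} \<inter> S = {} \<Longrightarrow>
      \<exists>(k::int) c. \<forall>t\<in>{a<..<b}. f (chart G e t) = of_int k * t + c"
    using rational_functionE[OF f e] by blast
  have "\<forall>\<^sub>F h in at_right 0. 0 < t + \<sigma> * h \<and> t + \<sigma> * h < elen G e \<and> t + \<sigma> * h \<notin> S"
    using eventually_leg_Inner[OF d[unfolded dd]] eventually_avoid_finite[OF S(1) s, of t]
    by eventually_elim auto
  then obtain b where b: "b > 0"
      "\<And>h. 0 < h \<Longrightarrow> h < b \<Longrightarrow> 0 < t + \<sigma> * h \<and> t + \<sigma> * h < elen G e \<and> t + \<sigma> * h \<notin> S"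
    unfolding eventually_at_right_field by blast
  \<comment> \<open>\<open>{lo<..<hi}\<close> lies on the side of \<open>t\<close> into which the
    leg runs. Stopping at \<open>b / 2\<close> keeps its far end inside the edge.\<close>
  define lo where "lo = min t (t + \<sigma> * (b / 2))"
  define hi where "hi = max t (t + \<sigma> * (b / 2))"
  have lohi: "0 \<le> lo" "lo < hi" "hi \<le> elen G e"
    using t b(1) b(2)[of "b/2"] s by (auto simp: lo_def hi_def)
  have "{lo<..<hi} \<inter> S = {}"
  proof -
    have False if "u \<in> {lo<..<hi}" "u \<in> S" for u
      using b(2)[of "\<sigma> * (u - t)"] b(1) s that by (auto simp: lo_def hi_def)
    then show ?thesis by blast
  qed
  with lohi obtain k :: int and c where kc: "\<And>u. u \<in> {lo<..<hi} \<Longrightarrow> f (chart G e u) = of_int k * u + c"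
    using S(2)[of lo hi] by blast
  have ev: "\<forall>\<^sub>F h in at_right 0. f (leg G d h) = of_int k * (t + \<sigma> * h) + c"
    unfolding eventually_at_right_field
  proof (intro exI[of _ "b/2"] conjI allI impI)
    fix h assume "0 < h" "h < b / 2"
    then have "t + \<sigma> * h \<in> {lo<..<hi}"
      using s by (auto simp: lo_def hi_def)
    then show "f (leg G d h) = of_int k * (t + \<sigma> * h) + c"
      using kc by (simp add: dd)
  qed (use b in auto)
  have "((\<lambda>h. f (leg G d h)) \<longlongrightarrow> f x) (at_right 0)"
  proof -
    obtain \<delta> where \<delta>: "\<delta> > 0" "continuous_map (top_of_set {0..\<delta>}) (realization G) (leg G d)"
      using continuous_map_leg[OF G d] by blast
    have "continuous_on {0..\<delta>} (\<lambda>h. f (leg G d h))"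
      using continuous_map_compose[OF \<delta>(2), of euclideanreal f] f
      by (simp add: rational_function_def o_def)
    then have "((\<lambda>h. f (leg G d h)) \<longlongrightarrow> f (leg G d 0)) (at 0 within {0..\<delta>})"
      using \<delta>(1) by (simp add: continuous_on_def)
    then show ?thesis
      using \<delta>(1) leg_0[OF d] at_within_Icc_at_right by metis
  qed
  moreover have "((\<lambda>h. f (leg G d h)) \<longlongrightarrow> of_int k * t + c) (at_right 0)"
  proof -
    have "((\<lambda>h. of_int k * (t + \<sigma> * h) + c) \<longlongrightarrow> of_int k * (t + \<sigma> * 0) + c) (at_right 0)"
      by (intro tendsto_intros)
    then show ?thesis
      using tendsto_cong[OF ev] by simp
  qed
  ultimately have fx: "f x = of_int k * t + c"
    using tendsto_unique trivial_limit_at_right_real by blast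
  \<comment> \<open>Slopes are measured away from \<open>x\<close>, so the coefficient changes sign
    when the leg runs against the orientation of the edge.\<close>
  obtain k' :: int where k': "of_int k' = of_int k * \<sigma>"
    using s by (metis mult_1_right mult_minus1_right of_int_minus)
  have ev': "\<forall>\<^sub>F h in at_right 0. f (leg G d h) = f x + of_int k' * h"
    using ev by eventually_elim (simp add: fx k' algebra_simps)
  with slope_eqI[OF d ev'] show ?thesis by simp
qed

lemma slope_mono:
  assumes G: "metric_graph G" and f: "rational_function G f" and h: "rational_function G h"
    and d: "d \<in> half_edges G x"
    and le: "\<forall>\<^sub>F s in at_right 0. f (leg G d s) \<le> h (leg G d s)" and eq: "f x = h x"
  shows "slope G f d \<le> slope G h d"
proof -
  have "\<forall>\<^sub>F s in at_right 0. s > 0 \<and> f x + of_int (slope G f d) * s \<le> h x + of_int (slope G h d) * s"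
    using le eventually_slope[OF G f d] eventually_slope[OF G h d] eventually_at_right_less
    by eventually_elim simp
  then obtain s :: real where "s > 0" "f x + of_int (slope G f d) * s \<le> h x + of_int (slope G h d) * s"
    using eventually_happens'[OF trivial_limit_at_right_real] by blast
  then show ?thesis
    using eq by simp
qed

text \<open>At a point where \<open>f\<close> attains the maximum \<open>h\<close>, this passes
  effectivity from \<open>K_plus_div G f\<close> to \<open>K_plus_div G h\<close>.\<close>

lemma ord_at_mono:
  assumes G: "metric_graph G" and f: "rational_function G f" and h: "rational_function G h"
    and le: "\<And>y. y \<in> points G \<Longrightarrow> f y \<le> h y" and eq: "f x = h x"
  shows "ord_at G f x \<le> ord_at G h x"
  unfolding ord_at_def
proof (rule sum_mono)
  fix d assume d: "d \<in> half_edges G x"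
  have "\<forall>\<^sub>F s in at_right 0. f (leg G d s) \<le> h (leg G d s)"
    using eventually_leg_avoid[OF G finite.emptyI d] by eventually_elim (use le in auto)
  then show "slope G f d \<le> slope G h d"
    using slope_mono[OF G f h d _ eq] by blast
qed

text \<open>The affine formula along the leg can be restarted at any nearby point of it, with the
  half-edge pointing away from \<open>x\<close>. This is how a zero or nonzero slope propagates from
  one point to its neighbours.\<close>

lemma leg_slope:
  assumes G: "metric_graph G" and f: "rational_function G f" and d: "d \<in> half_edges G x"
  shows "\<forall>\<^sub>F h in at_right 0. \<exists>d'\<in>half_edges G (leg G d h). slope G f d' = slope G f d"
proof -
  obtain e t \<sigma> where dd: "d = (e, t, \<sigma>)"
    by (cases d)
  have e: "e \<in> edges G" and s: "\<sigma> = 1 \<or> \<sigma> = -1"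
    using d dd by (auto simp: half_edges_def)
  let ?P = "\<lambda>h. h > 0 \<and> f (leg G d h) = f x + of_int (slope G f d) * h"
  have "\<forall>\<^sub>F h in at_right 0. ?P h"
    using eventually_slope[OF G f d] eventually_at_right_less by eventually_elim simp
  then obtain b where b: "b > 0" "\<And>h. 0 < h \<Longrightarrow> h < b \<Longrightarrow> ?P h"
    unfolding eventually_at_right_field by blast
  have "\<forall>\<^sub>F h in at_right 0. h < b"
    unfolding eventually_at_right_field using b by blast
  then show ?thesis
    using eventually_leg_Inner[OF d[unfolded dd]]
  proof eventually_elim
    case (elim h)
    define y where "y = leg G d h"
    have d': "(e, t + \<sigma> * h, \<sigma>) \<in> half_edges G y"
      using elim s half_edges_Inner[OF e, of "t + \<sigma> * h"] by (auto simp: dd y_def)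
    have "\<forall>\<^sub>F u in at_right 0. f (leg G (e, t + \<sigma> * h, \<sigma>) u) = f y + of_int (slope G f d) * u"
      unfolding eventually_at_right_field
    proof (intro exI[of _ "b - h"] conjI allI impI)
      fix u assume u: "0 < u" "u < b - h"
      have "leg G (e, t + \<sigma> * h, \<sigma>) u = leg G d (h + u)"
        by (simp add: dd algebra_simps)
      then show "f (leg G (e, t + \<sigma> * h, \<sigma>) u) = f y + of_int (slope G f d) * u"
        using b(2)[of h] b(2)[of "h + u"] u elim by (simp add: y_def algebra_simps)
    qed (use elim in auto)
    from slope_eqI[OF d' this] show ?case
      using d' y_def by blast
  qed
qed

section \<open>Orders of vanishing and the canonical divisor\<close>

lemma finite_ord_at:
  assumes G: "metric_graph G" and f: "rational_function G f"
  shows "finite {x \<in> points G. ord_at G f x \<noteq> 0}"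
proof -
  obtain S where S: "\<And>e. e \<in> edges G \<Longrightarrow> finite (S e)"
    "\<And>e a b. e \<in> edges G \<Longrightarrow> 0 \<le> a \<and> a < b \<and> b \<le> elen G e \<and> {a<..<b} \<inter> S e = {} \<Longrightarrow>
      \<exists>(k::int) c. \<forall>t\<in>{a<..<b}. f (chart G e t) = of_int k * t + c"
    using f unfolding rational_function_def by metis
  have "{x \<in> points G. ord_at G f x \<noteq> 0} \<subseteq> Vert ` verts G \<union> (\<Union>e\<in>edges G. Inner e ` S e)"
  proof
    fix x assume x: "x \<in> {x \<in> points G. ord_at G f x \<noteq> 0}"
    show "x \<in> Vert ` verts G \<union> (\<Union>e\<in>edges G. Inner e ` S e)"
    proof (rule ccontr)
      assume n: "x \<notin> Vert ` verts G \<union> (\<Union>e\<in>edges G. Inner e ` S e)"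
      then obtain e t where xt: "x = Inner e t" "e \<in> edges G" "0 < t" "t < elen G e" "t \<notin> S e"
        using x unfolding points_def by blast
      have "\<forall>\<^sub>F h in at_right 0. t + 1 * h \<notin> S e" "\<forall>\<^sub>F h in at_right 0. t + (-1) * h \<notin> S e"
        by (rule eventually_avoid_finite[OF S(1)[OF xt(2)]]; simp)+
      then have "\<forall>\<^sub>F h in at_right 0. t + h \<notin> S e \<and> t - h \<notin> S e"
        by eventually_elim simp
      then obtain b where b: "b > 0" "\<And>h. 0 < h \<Longrightarrow> h < b \<Longrightarrow> t + h \<notin> S e \<and> t - h \<notin> S e"
        unfolding eventually_at_right_field by blast
      \<comment> \<open>The interval of radius \<open>c\<close> around \<open>t\<close> stays in the
        edge and misses \<open>S e\<close>. One affine formula then covers both sides of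
        \<open>t\<close>, so the two outgoing slopes are \<open>k\<close> and \<open>- k\<close> and
        cancel.\<close>
      define c where "c = min b (min t (elen G e - t))"
      have c: "c > 0" "c \<le> b" "c \<le> t" "c \<le> elen G e - t"
        using b xt by (auto simp: c_def)
      have "{t - c<..<t + c} \<inter> S e = {}"
      proof -
        have False if "u \<in> {t - c<..<t + c}" "u \<in> S e" for u
          using b(2)[of "u - t"] b(2)[of "t - u"] c xt(5) that by (cases "u = t"; cases "u < t") auto
        then show ?thesis by blast
      qed
      then have "0 \<le> t - c \<and> t - c < t + c \<and> t + c \<le> elen G e \<and> {t - c<..<t + c} \<inter> S e = {}"
        using c by auto
      from S(2)[OF xt(2) this] obtain k :: int and a where
        ka: "\<And>u. u \<in> {t - c<..<t + c} \<Longrightarrow> f (chart G e u) = of_int k * u + a"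
        by blast
      have half: "half_edges G x = {(e, t, 1), (e, t, -1)}"
        unfolding xt(1) by (rule half_edges_Inner[OF xt(2-4)])
      have fx: "f x = of_int k * t + a"
        using ka[of t] c(1) by (simp add: xt chart_inner)
      have 1: "slope G f (e, t, 1) = k"
        by (rule slope_eqI[of _ _ x])
          (use c(1) ka half in \<open>auto simp: fx algebra_simps eventually_at_right_field intro!: exI[of _ c]\<close>)
      have 2: "slope G f (e, t, -1) = -k"
        by (rule slope_eqI[of _ _ x])
          (use c(1) ka half in \<open>auto simp: fx algebra_simps eventually_at_right_field intro!: exI[of _ c]\<close>)
      have "ord_at G f x = 0"
        unfolding ord_at_def half using 1 2 by simp
      then show False
        using x by simp
    qed
  qed
  moreover have "finite \<dots>"
    using G S(1) by (auto simp: metric_graph_def)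
  ultimately show ?thesis
    by (rule finite_subset)
qed

lemma val_Inner: "Inner e t \<in> points G \<Longrightarrow> val G (Inner e t) = 2"
  by (auto simp: points_def val_def half_edges_Inner)

text \<open>Inner points have valence two, so outside the finitely many vertices only the finite
  support of \<open>ord_at\<close> contributes.\<close>

lemma divisor_K_plus_div:
  assumes G: "metric_graph G" and f: "rational_function G f"
  shows "divisor G (K_plus_div G f)"
proof -
  have "{x. K_plus_div G f x \<noteq> 0} \<subseteq> Vert ` verts G \<union> {x \<in> points G. ord_at G f x \<noteq> 0}"
  proof
    fix x assume x: "x \<in> {x. K_plus_div G f x \<noteq> 0}"
    then have xp: "x \<in> points G"
      by (auto simp: K_plus_div_def canonical_divisor_def div_of_def split: if_splits)
    show "x \<in> Vert ` verts G \<union> {x \<in> points G. ord_at G f x \<noteq> 0}"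
    proof (cases x)
      case (Vert v)
      then show ?thesis
        using xp by (auto simp: points_def)
    next
      case (Inner e t)
      then show ?thesis
        using x xp val_Inner[of e t G]
        by (auto simp: K_plus_div_def canonical_divisor_def div_of_def)
    qed
  qed
  moreover have "finite (Vert ` verts G \<union> {x \<in> points G. ord_at G f x \<noteq> 0})"
    using finite_ord_at[OF G f] G by (auto simp: metric_graph_def)
  moreover have "Vert ` verts G \<union> {x \<in> points G. ord_at G f x \<noteq> 0} \<subseteq> points G"
    by (auto simp: points_def)
  ultimately show ?thesis
    unfolding divisor_def by (meson finite_subset order_trans)
qed

text \<open>One negative slope outweighs all positive ones together, and the other nonpositive
  slopes only lower the sum. Hence an inconvenient point lies in every vertex set containing the
  support of \<open>ord_at\<close>, and the criterion applies to it.\<close>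

lemma inconvenient_ord_neg:
  assumes G: "metric_graph G" and "inconvenient G f v"
  shows "ord_at G f v < 0"
proof -
  let ?H = "half_edges G v"
  let ?P = "{d' \<in> ?H. slope G f d' > 0}"
  obtain d where d: "d \<in> ?H" "slope G f d < 0" "- slope G f d > (\<Sum>d'\<in>?P. slope G f d')"
    using assms(2) unfolding inconvenient_def by blast
  have "(\<Sum>d'\<in>?H - ?P. slope G f d') = slope G f d + (\<Sum>d'\<in>?H - ?P - {d}. slope G f d')"
    using finite_half_edges[OF G, of v] d by (intro sum.remove) auto
  moreover have "(\<Sum>d'\<in>?H - ?P - {d}. slope G f d') \<le> 0"
    by (intro sum_nonpos) auto
  moreover have "ord_at G f v = (\<Sum>d'\<in>?H - ?P. slope G f d') + (\<Sum>d'\<in>?P. slope G f d')"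
    unfolding ord_at_def using finite_half_edges[OF G, of v] by (intro sum.subset_diff) auto
  ultimately show ?thesis
    using d(3) by linarith
qed

text \<open>On a gap between exceptional points both functions are affine, so they agree throughout
  or meet at most once. Adding the meeting points keeps the exceptional set finite.\<close>

lemma rational_function_max:
  assumes f: "rational_function G f" and g: "rational_function G g"
  shows "rational_function G (\<lambda>x. max (f x) (g x))"
  unfolding rational_function_def
proof (intro conjI ballI)
  show "continuous_map (realization G) euclideanreal (\<lambda>x. max (f x) (g x))"
    using f g by (intro continuous_map_real_max) (auto simp: rational_function_def)
next
  fix e assume e: "e \<in> edges G"
  obtain Sf where Sf: "finite Sf" "\<And>a b. 0 \<le> a \<Longrightarrow> a < b \<Longrightarrow> b \<le> elen G e \<Longrightarrow> {a<..<b} \<inter> Sf = {} \<Longrightarrow>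
      \<exists>(k::int) c. \<forall>t\<in>{a<..<b}. f (chart G e t) = of_int k * t + c"
    using rational_functionE[OF f e] by blast
  obtain Sg where Sg: "finite Sg" "\<And>a b. 0 \<le> a \<Longrightarrow> a < b \<Longrightarrow> b \<le> elen G e \<Longrightarrow> {a<..<b} \<inter> Sg = {} \<Longrightarrow>
      \<exists>(k::int) c. \<forall>t\<in>{a<..<b}. g (chart G e t) = of_int k * t + c"
    using rational_functionE[OF g e] by blast
  \<comment> \<open>The ends of the edge are included so that every interval \<open>{a<..<b}\<close>
    has elements of \<open>T\<close> on both sides.\<close>
  define T where "T = insert 0 (insert (elen G e) (Sf \<union> Sg))"
  define z where "z p q = (SOME t. t \<in> {p<..<q} \<and> f (chart G e t) = g (chart G e t))" for p q
  define S where "S = T \<union> (\<lambda>(p, q). z p q) ` (T \<times> T)"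
  have T: "finite T"
    using Sf(1) Sg(1) by (simp add: T_def)
  show "\<exists>S. finite S \<and> (\<forall>a b. 0 \<le> a \<and> a < b \<and> b \<le> elen G e \<and> {a<..<b} \<inter> S = {} \<longrightarrow>
      (\<exists>(k::int) c. \<forall>t\<in>{a<..<b}. max (f (chart G e t)) (g (chart G e t)) = of_int k * t + c))"
  proof (intro exI[of _ S] conjI allI impI)
    show "finite S"
      using T by (simp add: S_def)
    fix a b assume "0 \<le> a \<and> a < b \<and> b \<le> elen G e \<and> {a<..<b} \<inter> S = {}"
    then have ab: "0 \<le> a" "a < b" "b \<le> elen G e" and S: "{a<..<b} \<inter> S = {}"
      by auto
    \<comment> \<open>The affine formulas are taken on the whole gap \<open>{p<..<q}\<close> around
      \<open>{a<..<b}\<close>, since the chosen meeting point is indexed by the ends of the gap and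
      may lie outside \<open>{a<..<b}\<close>.\<close>
    define p where "p = Max {s \<in> T. s \<le> a}"
    define q where "q = Min {s \<in> T. b \<le> s}"
    have "p \<in> {s \<in> T. s \<le> a}"
      unfolding p_def using T ab(1) by (intro Max_in) (auto simp: T_def)
    moreover have "q \<in> {s \<in> T. b \<le> s}"
      unfolding q_def using T ab(3) by (intro Min_in) (auto simp: T_def)
    ultimately have pq: "p \<in> T" "p \<le> a" "q \<in> T" "b \<le> q"
      by auto
    have pql: "0 \<le> p" "q \<le> elen G e"
      unfolding p_def q_def using T ab by (auto intro!: Max_ge Min_le simp: T_def)
    have "u \<notin> T" if "u \<in> {p<..<q}" for u
    proof
      assume u: "u \<in> T"
      have "u \<le> p" if "u \<le> a"
        unfolding p_def using T u that by (intro Max_ge) auto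
      moreover have "q \<le> u" if "b \<le> u"
        unfolding q_def using T u that by (intro Min_le) auto
      ultimately have "u \<in> {a<..<b}"
        using \<open>u \<in> {p<..<q}\<close> by force
      then show False
        using S u by (auto simp: S_def)
    qed
    then have "{p<..<q} \<inter> Sf = {}" "{p<..<q} \<inter> Sg = {}"
      by (auto simp: T_def)
    then obtain k k' :: int and c c'
      where F: "\<And>t. t \<in> {p<..<q} \<Longrightarrow> f (chart G e t) = of_int k * t + c"
        and G: "\<And>t. t \<in> {p<..<q} \<Longrightarrow> g (chart G e t) = of_int k' * t + c'"
      using Sf(2)[of p q] Sg(2)[of p q] pql pq ab(2) by (smt (verit))
    have sub: "t \<in> {p<..<q}" if "t \<in> {a<..<b}" for t
      using that pq by auto
    show "\<exists>(k::int) c. \<forall>t\<in>{a<..<b}. max (f (chart G e t)) (g (chart G e t)) = of_int k * t + c"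
    proof (cases "\<exists>t\<in>{a<..<b}. f (chart G e t) = g (chart G e t)")
      \<comment> \<open>The chosen meeting point belongs to \<open>S\<close> and so differs from
        \<open>t\<close>. Two affine functions with two meeting points coincide.\<close>
      case True
      then obtain t where t: "t \<in> {a<..<b}" "f (chart G e t) = g (chart G e t)"
        by blast
      have z: "z p q \<in> {p<..<q} \<and> f (chart G e (z p q)) = g (chart G e (z p q))"
        unfolding z_def by (rule someI[of _ t]) (use t sub in auto)
      have "z p q \<in> S"
        unfolding S_def using pq by auto
      then have "z p q \<noteq> t"
        using t S by auto
      moreover have "(of_int k - of_int k') * (z p q - t) = (0::real)"
        using z t F[of "z p q"] G[of "z p q"] F[OF sub[OF t(1)]] G[OF sub[OF t(1)]]
        by (simp add: algebra_simps)
      ultimately have "k = k'"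
        by simp
      then have "c = c'"
        using F[OF sub[OF t(1)]] G[OF sub[OF t(1)]] t(2) by simp
      then show ?thesis
        using F G sub \<open>k = k'\<close> by (intro exI[of _ k] exI[of _ c]) simp
    next
      case False
      define u where "u t = (of_int k * t + c) - (of_int k' * t + c')" for t :: real
      have "connected (u ` {a<..<b})"
        unfolding u_def by (intro connected_continuous_image continuous_intros) simp
      moreover have u: "u t = f (chart G e t) - g (chart G e t)" if "t \<in> {a<..<b}" for t
        using F G sub that by (simp add: u_def)
      then have "0 \<notin> u ` {a<..<b}"
        using False by auto
      ultimately have "\<not> (\<exists>x\<in>u ` {a<..<b}. \<exists>y\<in>u ` {a<..<b}. x \<le> 0 \<and> 0 \<le> y)"
        using connectedD_interval by blast
      then have "(\<forall>t\<in>{a<..<b}. u t < 0) \<or> (\<forall>t\<in>{a<..<b}. u t > 0)"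
        by (metis imageI linear not_less)
      then show ?thesis
      proof
        assume "\<forall>t\<in>{a<..<b}. u t < 0"
        then show ?thesis
          using u sub G by (intro exI[of _ k'] exI[of _ c']) (fastforce simp: max_def)
      next
        assume "\<forall>t\<in>{a<..<b}. u t > 0"
        then show ?thesis
          using u sub F by (intro exI[of _ k] exI[of _ c]) (fastforce simp: max_def)
      qed
    qed
  qed
qed

section \<open>Invariance under additive constants\<close>

lemma rational_function_add_const:
  assumes "rational_function G f"
  shows "rational_function G (\<lambda>x. c + f x)"
  unfolding rational_function_def
proof (intro conjI ballI)
  show "continuous_map (realization G) euclideanreal (\<lambda>x. c + f x)"
    using assms by (intro continuous_map_add) (auto simp: rational_function_def)
next
  fix e assume e: "e \<in> edges G"
  obtain S where S: "finite S" "\<And>a b. 0 \<le> a \<Longrightarrow> a < b \<Longrightarrow> b \<le> elen G e \<Longrightarrow> {a<..<b} \<inter> S = {} \<Longrightarrow>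
      \<exists>(k::int) c. \<forall>t\<in>{a<..<b}. f (chart G e t) = of_int k * t + c"
    using rational_functionE[OF assms e] by blast
  show "\<exists>S. finite S \<and> (\<forall>a b. 0 \<le> a \<and> a < b \<and> b \<le> elen G e \<and> {a<..<b} \<inter> S = {} \<longrightarrow>
      (\<exists>(k::int) c'. \<forall>t\<in>{a<..<b}. c + f (chart G e t) = of_int k * t + c'))"
  proof (intro exI[of _ S] conjI allI impI S(1))
    fix a b assume "0 \<le> a \<and> a < b \<and> b \<le> elen G e \<and> {a<..<b} \<inter> S = {}"
    then obtain k :: int and c' where "\<forall>t\<in>{a<..<b}. f (chart G e t) = of_int k * t + c'"
      using S(2) by blast
    then show "\<exists>(k::int) c'. \<forall>t\<in>{a<..<b}. c + f (chart G e t) = of_int k * t + c'"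
      by (intro exI[of _ k] exI[of _ "c + c'"]) simp
  qed
qed

text \<open>The functions are total on the type of points, but two functions with the same divisor
  are comparable on \<open>points G\<close> only; hence the form of the hypothesis
  \<open>eq\<close>.\<close>

lemma slope_add_const:
  assumes G: "metric_graph G" and f: "rational_function G f" and d: "d \<in> half_edges G x"
    and eq: "\<And>y. y \<in> points G \<Longrightarrow> g y = c + f y" and x: "x \<in> points G"
  shows "slope G g d = slope G f d"
proof (rule slope_eqI[OF d])
  show "\<forall>\<^sub>F h in at_right 0. g (leg G d h) = g x + of_int (slope G f d) * h"
    using eventually_slope[OF G f d] eventually_leg_avoid[OF G finite.emptyI d]
    by eventually_elim (simp add: eq x)
qed

lemma ord_at_add_const:
  assumes "metric_graph G" "rational_function G f" "\<And>y. y \<in> points G \<Longrightarrow> g y = c + f y" "x \<in> points G"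
  shows "ord_at G g x = ord_at G f x"
  unfolding ord_at_def by (rule sum.cong[OF refl], rule slope_add_const[OF assms(1,2)]) (use assms in auto)

lemma K_plus_div_add_const:
  assumes "metric_graph G" "rational_function G f" "\<And>y. y \<in> points G \<Longrightarrow> g y = c + f y"
  shows "K_plus_div G g = K_plus_div G f"
  using ord_at_add_const[OF assms] by (auto simp: K_plus_div_def div_of_def)

lemma inconvenient_add_const:
  assumes "metric_graph G" "rational_function G f" "\<And>y. y \<in> points G \<Longrightarrow> g y = c + f y" "x \<in> points G"
  shows "inconvenient G g x \<longleftrightarrow> inconvenient G f x"
proof -
  have *: "slope G g d = slope G f d" if "d \<in> half_edges G x" for d
    using slope_add_const[OF assms(1,2) that assms(3,4)] by blast
  have "{d' \<in> half_edges G x. slope G g d' > 0} = {d' \<in> half_edges G x. slope G f d' > 0}"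
    using * by auto
  then have "(\<Sum>d' | d' \<in> half_edges G x \<and> slope G g d' > 0. slope G g d') =
      (\<Sum>d' | d' \<in> half_edges G x \<and> slope G f d' > 0. slope G f d')"
    using * by (intro sum.cong) auto
  then show ?thesis
    using * by (simp add: inconvenient_def)
qed

lemma simple_cycle_subset_points:
  assumes "metric_graph G" "simple_cycle G Z"
  shows "Z \<subseteq> points G"
proof -
  obtain \<gamma> where "pathin (realization G) \<gamma>" "Z = \<gamma> ` {0..1}"
    using assms(2) unfolding simple_cycle_def by blast
  then show ?thesis
    using path_image_subset_topspace topspace_realization[OF assms(1)]
    by (metis image_subset_iff_funcset)
qed

lemma model_edge_props:
  assumes G: "metric_graph G" and C: "C \<in> model_edges G V"
  shows "C \<subseteq> points G - V" "connectedin (realization G) C" "C \<noteq> {}"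
proof -
  note C' = C[unfolded model_edges_def]
  show "C \<subseteq> points G - V"
    using connected_components_of_subset[OF C'] by (auto simp: topspace_realization[OF G])
  show "connectedin (realization G) C"
    using connectedin_connected_components_of[OF C'] by (simp add: connectedin_subtopology)
  show "C \<noteq> {}"
    by (rule nonempty_connected_components_of[OF C'])
qed

lemma realizability_criterion_add_const:
  assumes G: "metric_graph G" and f: "rational_function G f"
    and eq: "\<And>y. y \<in> points G \<Longrightarrow> g y = c + f y" and V: "V \<subseteq> points G"
    and crit: "realizability_criterion G V f"
  shows "realizability_criterion G V g"
  unfolding realizability_criterion_def
proof (intro conjI ballI impI)
  fix v assume v: "v \<in> V" "inconvenient G g v"
  then have "inconvenient G f v"
    using inconvenient_add_const[OF G f eq] V by blast
  then obtain Z where "simple_cycle G Z" "v \<in> Z" "\<forall>z\<in>Z. f z \<ge> f v"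
    using crit v(1) unfolding realizability_criterion_def by blast
  then show "\<exists>Z. simple_cycle G Z \<and> v \<in> Z \<and> (\<forall>z\<in>Z. g z \<ge> g v)"
    using simple_cycle_subset_points[OF G] eq by (intro exI[of _ Z]) (auto simp: subset_iff)
next
  fix e assume e: "e \<in> model_edges G V" "horizontal g e"
  have ep: "e \<subseteq> points G"
    using model_edge_props(1)[OF G e(1)] by blast
  obtain a where "\<forall>x\<in>e. g x = a"
    using e(2) unfolding horizontal_def constant_on_def by blast
  then have "\<forall>x\<in>e. f x = a - c"
    using ep eq by (auto simp: subset_iff)
  then have "horizontal f e"
    unfolding horizontal_def constant_on_def by blast
  then obtain Z where "simple_cycle G Z" "e \<subseteq> Z" "\<forall>z\<in>Z. \<forall>x\<in>e. f z \<ge> f x"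
    using crit e(1) unfolding realizability_criterion_def by blast
  then show "\<exists>Z. simple_cycle G Z \<and> e \<subseteq> Z \<and> (\<forall>z\<in>Z. \<forall>x\<in>e. g z \<ge> g x)"
    using simple_cycle_subset_points[OF G] ep eq by (intro exI[of _ Z]) (auto simp: subset_iff)
qed

subsection \<open>Cycles and edges of models\<close>

text \<open>A continuous real function vanishing exactly at one point separates it from all others,
  which gives the Hausdorff property. In the quotient topology it suffices to write such a function
  down edge by edge, with matching values at the vertices.\<close>

lemma separating_function:
  fixes G :: "('v, 'e) graph"
  assumes G: "metric_graph G"
  shows "\<exists>u. continuous_map (realization G) euclideanreal u \<and> (\<forall>x\<in>points G. u x = 0 \<longleftrightarrow> x = p)"
proof (cases p)
  case (Vert v)
  define a where "a w = (if w = v then 0 else 1 :: real)" for w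
  \<comment> \<open>Linear interpolation of the end values plus a bump that is positive inside the
    edge. The bump is there for loops at \<open>v\<close>, on which the interpolation vanishes
    identically.\<close>
  define \<phi> where "\<phi> e t = a (tail G e) * (1 - t / elen G e) + a (head G e) * (t / elen G e)
      + t * (elen G e - t)" for e t
  define u where "u x = (case x of Vert w \<Rightarrow> a w | Inner e t \<Rightarrow> \<phi> e t)" for x :: "('v, 'e) point"
  have "continuous_map (realization G) euclideanreal u"
  proof (rule continuous_map_realizationI[OF G])
    fix e assume e: "e \<in> edges G"
    note l = metric_graph_elen[OF G e]
    have "continuous_on {0..elen G e} (\<phi> e)"
      unfolding \<phi>_def using l by (intro continuous_intros) auto
    then show "continuous_on {0..elen G e} (\<lambda>t. u (chart G e t))"
      by (rule continuous_on_eq) (use l in \<open>auto simp: u_def \<phi>_def chart_def\<close>)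
  qed
  moreover have "u x = 0 \<longleftrightarrow> x = p" if x: "x \<in> points G" for x
  proof (cases x)
    case (Inner e t)
    then have t: "0 < t" "t < elen G e"
      using x by (auto simp: points_def)
    then have "0 < t * (elen G e - t)"
      by simp
    moreover have "0 \<le> a (tail G e) * (1 - t / elen G e) + a (head G e) * (t / elen G e)"
      using t by (auto simp: a_def)
    ultimately show ?thesis
      by (simp add: u_def Inner Vert \<phi>_def)
  qed (simp add: u_def Vert a_def)
  ultimately show ?thesis
    by blast
next
  case (Inner e0 t0)
  show ?thesis
  proof (cases "p \<in> points G")
    case True
    then have e0: "e0 \<in> edges G" and t0: "0 < t0" "t0 < elen G e0"
      by (auto simp: points_def Inner)
    \<comment> \<open>The factor of \<open>\<bar>t - t0\<bar>\<close> is positive on the edge and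
      interpolates between \<open>1 / t0\<close> and \<open>1 / (elen G e0 - t0)\<close>, which
      makes \<open>\<phi>\<close> equal to \<open>1\<close> at both ends, matching the constant
      \<open>1\<close> elsewhere.\<close>
    define \<phi> where "\<phi> t = \<bar>t - t0\<bar> * ((1 - t / elen G e0) / t0 + (t / elen G e0) / (elen G e0 - t0))" for t
    define u where "u x = (case x of Vert w \<Rightarrow> 1 | Inner e t \<Rightarrow> if e = e0 then \<phi> t else 1)"
      for x :: "('v, 'e) point"
    have \<phi>: "\<phi> 0 = 1" "\<phi> (elen G e0) = 1"
      using t0 by (auto simp: \<phi>_def)
    have "continuous_map (realization G) euclideanreal u"
    proof (rule continuous_map_realizationI[OF G])
      fix e assume e: "e \<in> edges G"
      note l = metric_graph_elen[OF G e]
      have "continuous_on {0..elen G e} (if e = e0 then \<phi> else (\<lambda>_. 1))"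
        unfolding \<phi>_def using t0 by (auto intro!: continuous_intros)
      then show "continuous_on {0..elen G e} (\<lambda>t. u (chart G e t))"
        by (rule continuous_on_eq) (use l \<phi> in \<open>auto simp: u_def chart_def\<close>)
    qed
    moreover have "u x = 0 \<longleftrightarrow> x = p" if x: "x \<in> points G" for x
    proof (cases "\<exists>t. x = Inner e0 t")
      case True
      then obtain t where xt: "x = Inner e0 t" by blast
      then have t: "0 < t" "t < elen G e0"
        using x by (auto simp: points_def)
      then have "0 < (1 - t / elen G e0) / t0" "0 < (t / elen G e0) / (elen G e0 - t0)"
        using t0 by auto
      then show ?thesis
        by (simp add: u_def xt Inner \<phi>_def)
    qed (auto simp: u_def Inner split: point.splits)
    ultimately show ?thesis
      by blast
  next
    case False
    then show ?thesis
      by (intro exI[of _ "\<lambda>_. 1"]) auto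
  qed
qed

lemma Hausdorff_realization:
  assumes G: "metric_graph G"
  shows "Hausdorff_space (realization G)"
  unfolding Hausdorff_space_def topspace_realization[OF G]
proof (intro allI impI)
  fix x y assume xy: "x \<in> points G \<and> y \<in> points G \<and> x \<noteq> y"
  obtain u where u: "continuous_map (realization G) euclideanreal u"
      "\<And>z. z \<in> points G \<Longrightarrow> u z = 0 \<longleftrightarrow> z = x"
    using separating_function[OF G, of x] by blast
  have "u x = 0" "u y \<noteq> 0"
    using u(2) xy by blast+
  then have "u x \<noteq> u y"
    by simp
  then obtain A B where AB: "open A" "open B" "u x \<in> A" "u y \<in> B" "A \<inter> B = {}"
    using hausdorff[of "u x" "u y"] by blast
  have "openin (realization G) {z \<in> points G. u z \<in> A}" "openin (realization G) {z \<in> points G. u z \<in> B}"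
    using openin_continuous_map_preimage[OF u(1)] AB(1,2) topspace_realization[OF G] by auto
  moreover have "disjnt {z \<in> points G. u z \<in> A} {z \<in> points G. u z \<in> B}"
    using AB(5) by (auto simp: disjnt_iff)
  ultimately show "\<exists>U V. openin (realization G) U \<and> openin (realization G) V \<and> x \<in> U \<and> y \<in> V \<and> disjnt U V"
    using xy AB(3,4) by (intro exI[of _ "{z \<in> points G. u z \<in> A}"] exI[of _ "{z \<in> points G. u z \<in> B}"]) auto
qed

text \<open>A simple cycle is a compact set in a Hausdorff space, hence closed. This puts an
  endpoint of an open model edge on every cycle that contains the edge.\<close>

lemma simple_cycle_closed:
  assumes G: "metric_graph G" and Z: "simple_cycle G Z" and x: "x \<in> points G" "d \<in> half_edges G x"
    and ev: "\<forall>\<^sub>F h in at_right 0. leg G d h \<in> Z"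
  shows "x \<in> Z"
proof (rule ccontr)
  assume n: "x \<notin> Z"
  have "compactin (realization G) Z"
    using Z compactin_path_image unfolding simple_cycle_def by blast
  then have "closedin (realization G) Z"
    by (rule compactin_imp_closedin[OF Hausdorff_realization[OF G]])
  then have "openin (realization G) (points G - Z)"
    by (simp add: closedin_def topspace_realization[OF G])
  then have "\<forall>\<^sub>F h in at_right 0. leg G d h \<in> points G - Z"
    using n x unfolding openin_realization_iff[OF G] by blast
  with ev have "\<forall>\<^sub>F h in at_right (0::real). False"
    by eventually_elim simp
  then show False
    by simp
qed

section \<open>The local shape of a model edge\<close>

lemma legs_disjoint:
  assumes d: "d \<in> half_edges G x" "d' \<in> half_edges G x" "d \<noteq> d'" and G: "metric_graph G"
  shows "\<exists>b>0. \<forall>h h'. 0 < h \<and> h < b \<and> 0 < h' \<and> h' < b \<longrightarrow> leg G d h \<noteq> leg G d' h'"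
proof -
  obtain e t \<sigma> e' t' \<sigma>' where dd: "d = (e, t, \<sigma>)" "d' = (e', t', \<sigma>')"
    by (cases d, cases d')
  obtain b where b: "b > 0" "\<And>h. 0 < h \<Longrightarrow> h < b \<Longrightarrow> leg G d h = Inner e (t + \<sigma> * h)"
    using eventually_leg_Inner[OF d(1)[unfolded dd]] unfolding eventually_at_right_field dd by blast
  obtain b' where b': "b' > 0" "\<And>h. 0 < h \<Longrightarrow> h < b' \<Longrightarrow> leg G d' h = Inner e' (t' + \<sigma>' * h)"
    using eventually_leg_Inner[OF d(2)[unfolded dd]] unfolding eventually_at_right_field dd by blast
  have l: "elen G e > 0"
    using d(1) metric_graph_elen[OF G] by (auto simp: dd half_edges_def)
  \<comment> \<open>The bound \<open>elen G e / 2\<close> keeps the two legs of a loop, which start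
    at its opposite ends, from running into each other.\<close>
  define c where "c = min (elen G e / 2) (min b b')"
  have "leg G d h \<noteq> leg G d' h'" if h: "0 < h" "h < c" "0 < h'" "h' < c" for h h'
  proof
    assume "leg G d h = leg G d' h'"
    then have eq: "e = e'" "t + \<sigma> * h = t' + \<sigma>' * h'"
      using b(2)[of h] b'(2)[of h'] h by (auto simp: c_def)
    then have "t \<noteq> t' \<or> \<sigma> \<noteq> \<sigma>'"
      using d(3) dd by auto
    then show False
      using d(1,2) eq h unfolding dd half_edges_def chart_def c_def
      by (auto split: if_splits)
  qed
  then show ?thesis
    using b(1) b'(1) l by (intro exI[of _ c]) (auto simp: c_def)
qed

text \<open>If both arcs left the common start to the same side, the one ending farther away would
  pass through the endpoint of the other, by the intermediate value theorem.\<close>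

lemma continuous_arcs_meet:
  fixes u v :: "real \<Rightarrow> real"
  assumes "0 < c" "continuous_on {0..c} u" "continuous_on {0..c} v" "u 0 = v 0"
    and "\<And>h h'. 0 < h \<Longrightarrow> h \<le> c \<Longrightarrow> 0 < h' \<Longrightarrow> h' \<le> c \<Longrightarrow> u h \<noteq> v h'"
    and "\<And>h. 0 < h \<Longrightarrow> h \<le> c \<Longrightarrow> u h \<noteq> u 0 \<and> v h \<noteq> v 0"
  shows "(u c - u 0) * (v c - v 0) < 0"
proof (rule ccontr)
  have key: False
    if uv: "v' 0 < u' c" "u' c \<le> v' c" "continuous_on {0..c} v'"
      "\<And>h h'. 0 < h \<Longrightarrow> h \<le> c \<Longrightarrow> 0 < h' \<Longrightarrow> h' \<le> c \<Longrightarrow> u' h \<noteq> v' h'" for u' v' :: "real \<Rightarrow> real"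
  proof -
    obtain s where "0 \<le> s" "s \<le> c" "v' s = u' c"
      using IVT'[of v' 0 "u' c" c] uv(1-3) assms(1) by auto
    then show False
      using uv(1) uv(4)[of c s] assms(1) by (cases "s = 0") auto
  qed
  assume "\<not> (u c - u 0) * (v c - v 0) < 0"
  moreover have "u c \<noteq> u 0" "v c \<noteq> v 0"
    using assms(6)[of c] assms(1) by auto
  ultimately consider "u c > u 0" "v c > v 0" | "u c < u 0" "v c < v 0"
    by (metis diff_gt_0_iff_gt diff_less_0_iff_less linorder_neqE_linordered_idom mult_neg_pos mult_pos_neg)
  then show False
  proof cases
    case 1
    then show False
      using key[of v u] key[of u v] assms by (metis linear)
  next
    case 2
    have "continuous_on {0..c} (\<lambda>h. - u h)" "continuous_on {0..c} (\<lambda>h. - v h)"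
      using assms(2,3) by (auto intro: continuous_on_minus)
    then show False
      using key[of "\<lambda>h. - v h" "\<lambda>h. - u h"] key[of "\<lambda>h. - u h" "\<lambda>h. - v h"] assms(4,5) 2
      by (metis linear neg_equal_iff_equal neg_less_iff_less)
  qed
qed

text \<open>Two of three arcs leaving a point of an open interval start into the same side and hence meet.\<close>

lemma model_edge_no_three_half_edges:
  assumes G: "metric_graph G" and V: "model G V" and C: "C \<in> model_edges G V" and x: "x \<in> C"
    and d: "d1 \<in> half_edges G x" "d2 \<in> half_edges G x" "d3 \<in> half_edges G x"
    and ne: "d1 \<noteq> d2" "d1 \<noteq> d3" "d2 \<noteq> d3"
  shows False
proof -
  have xp: "x \<in> points G"
    using model_edge_props(1)[OF G C] x by blast
  have finV: "finite V"
    using V by (simp add: model_def)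
  have "subtopology (realization G) C homeomorphic_space top_of_set {0<..<1::real}"
    using V C by (simp add: model_def)
  then obtain \<psi> \<theta> where hom: "homeomorphic_maps (subtopology (realization G) C) (top_of_set {0<..<1::real}) \<psi> \<theta>"
    unfolding homeomorphic_space_def by blast
  have cont: "continuous_map (subtopology (realization G) C) euclideanreal \<psi>"
    using hom unfolding homeomorphic_maps_def by (simp add: continuous_map_in_subtopology)
  have inj: "\<psi> y = \<psi> z \<Longrightarrow> y = z" if "y \<in> C" "z \<in> C" for y z
    using hom that model_edge_props(1)[OF G C] topspace_realization[OF G]
    unfolding homeomorphic_maps_def by (metis Diff_subset IntI subsetD order_trans topspace_subtopology)
  have arc: "\<exists>b>0. \<forall>c. 0 < c \<and> c < b \<longrightarrow> continuous_on {0..c} (\<lambda>h. \<psi> (leg G d h)) \<and>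
      (\<forall>h. 0 \<le> h \<and> h \<le> c \<longrightarrow> leg G d h \<in> C) \<and> (\<forall>h. 0 < h \<and> h \<le> c \<longrightarrow> leg G d h \<noteq> x)"
    if d: "d \<in> half_edges G x" for d
  proof -
    obtain \<delta> where \<delta>: "\<delta> > 0" "continuous_map (top_of_set {0..\<delta>}) (realization G) (leg G d)"
      using continuous_map_leg[OF G d] by blast
    have "\<forall>\<^sub>F h in at_right 0. leg G d h \<in> C \<and> leg G d h \<noteq> x"
      using leg_in_component(2)[OF G finV d xp C x] eventually_leg_avoid[OF G _ d, of "{x}"]
      by (auto simp: eventually_conj_iff elim: eventually_mono)
    then obtain b where b: "b > 0" "\<And>h. 0 < h \<Longrightarrow> h < b \<Longrightarrow> leg G d h \<in> C \<and> leg G d h \<noteq> x"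
      unfolding eventually_at_right_field by blast
    show ?thesis
    proof (intro exI[of _ "min b \<delta>"] conjI allI impI)
      fix c assume c: "0 < c \<and> c < min b \<delta>"
      show *: "leg G d h \<in> C" if "0 \<le> h \<and> h \<le> c" for h
        using that b(2)[of h] c leg_0[OF d] x by (cases "h = 0") auto
      show "leg G d h \<noteq> x" if "0 < h \<and> h \<le> c" for h
        using that b(2)[of h] c by auto
      have "continuous_map (top_of_set {0..c}) (realization G) (leg G d)"
        using continuous_map_from_subtopology_mono[OF \<delta>(2), of "{0..c}"] c by auto
      then have "continuous_map (top_of_set {0..c}) (subtopology (realization G) C) (leg G d)"
        using * by (auto simp: continuous_map_in_subtopology)
      from continuous_map_compose[OF this cont]
      show "continuous_on {0..c} (\<lambda>h. \<psi> (leg G d h))"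
        by (simp add: o_def)
    qed (use b \<delta> in auto)
  qed
  \<comment> \<open>Transported to the line by \<open>\<psi>\<close>, two different legs are arcs
    without common points apart from their start, so they leave \<open>\<psi> x\<close> to opposite
    sides.\<close>
  have neg: "\<exists>b>0. \<forall>c. 0 < c \<and> c < b \<longrightarrow> (\<psi> (leg G d c) - \<psi> x) * (\<psi> (leg G d' c) - \<psi> x) < 0"
    if d: "d \<in> half_edges G x" "d' \<in> half_edges G x" "d \<noteq> d'" for d d'
  proof -
    obtain b1 where b1: "b1 > 0" "\<And>c. 0 < c \<and> c < b1 \<Longrightarrow> continuous_on {0..c} (\<lambda>h. \<psi> (leg G d h)) \<and>
      (\<forall>h. 0 \<le> h \<and> h \<le> c \<longrightarrow> leg G d h \<in> C) \<and> (\<forall>h. 0 < h \<and> h \<le> c \<longrightarrow> leg G d h \<noteq> x)"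
      using arc[OF d(1)] by blast
    obtain b2 where b2: "b2 > 0" "\<And>c. 0 < c \<and> c < b2 \<Longrightarrow> continuous_on {0..c} (\<lambda>h. \<psi> (leg G d' h)) \<and>
      (\<forall>h. 0 \<le> h \<and> h \<le> c \<longrightarrow> leg G d' h \<in> C) \<and> (\<forall>h. 0 < h \<and> h \<le> c \<longrightarrow> leg G d' h \<noteq> x)"
      using arc[OF d(2)] by blast
    obtain b3 where b3: "b3 > 0"
      "\<And>h h'. 0 < h \<and> h < b3 \<and> 0 < h' \<and> h' < b3 \<Longrightarrow> leg G d h \<noteq> leg G d' h'"
      using legs_disjoint[OF d G] by blast
    have "(\<psi> (leg G d c) - \<psi> x) * (\<psi> (leg G d' c) - \<psi> x) < 0"
      if c: "0 < c \<and> c < min b1 (min b2 b3)" for c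
    proof -
      have c1: "0 < c \<and> c < b1" and c2: "0 < c \<and> c < b2" and c3: "c < b3"
        using c by auto
      have 0: "leg G d 0 = x" "leg G d' 0 = x"
        using leg_0[OF d(1)] leg_0[OF d(2)] .
      have "(\<psi> (leg G d c) - \<psi> (leg G d 0)) * (\<psi> (leg G d' c) - \<psi> (leg G d' 0)) < 0"
      proof (rule continuous_arcs_meet)
        fix h h' :: real assume h: "0 < h" "h \<le> c" "0 < h'" "h' \<le> c"
        show "\<psi> (leg G d h) \<noteq> \<psi> (leg G d' h')"
          using inj[of "leg G d h" "leg G d' h'"] b1(2)[OF c1] b2(2)[OF c2] b3(2)[of h h'] h c3 by auto
      next
        fix h :: real assume h: "0 < h" "h \<le> c"
        show "\<psi> (leg G d h) \<noteq> \<psi> (leg G d 0) \<and> \<psi> (leg G d' h) \<noteq> \<psi> (leg G d' 0)"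
          using inj[of "leg G d h" x] inj[of "leg G d' h" x] b1(2)[OF c1] b2(2)[OF c2] h x
          unfolding 0 by auto
      qed (use c1 b1(2)[OF c1] b2(2)[OF c2] 0 in auto)
      then show ?thesis
        by (simp only: 0)
    qed
    then show ?thesis
      using b1(1) b2(1) b3(1) by (intro exI[of _ "min b1 (min b2 b3)"]) auto
  qed
  obtain a b c where abc: "0 < a" "0 < b" "0 < c"
    "\<And>s. 0 < s \<and> s < a \<Longrightarrow> (\<psi> (leg G d1 s) - \<psi> x) * (\<psi> (leg G d2 s) - \<psi> x) < 0"
    "\<And>s. 0 < s \<and> s < b \<Longrightarrow> (\<psi> (leg G d1 s) - \<psi> x) * (\<psi> (leg G d3 s) - \<psi> x) < 0"
    "\<And>s. 0 < s \<and> s < c \<Longrightarrow> (\<psi> (leg G d2 s) - \<psi> x) * (\<psi> (leg G d3 s) - \<psi> x) < 0"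
    using neg[OF d(1,2) ne(1)] neg[OF d(1,3) ne(2)] neg[OF d(2,3) ne(3)] by blast
  define s where "s = min a (min b c) / 2"
  have s: "0 < s \<and> s < a" "0 < s \<and> s < b" "0 < s \<and> s < c"
    using abc(1-3) by (auto simp: s_def)
  \<comment> \<open>Three real numbers cannot have pairwise negative products.\<close>
  show False
    using abc(4)[OF s(1)] abc(5)[OF s(2)] abc(6)[OF s(3)] by (auto simp: mult_less_0_iff)
qed

text \<open>At each point of the edge the slopes sum to zero and there are at most two half-edges,
  so one vanishing slope forces all of them to vanish. The vanishing spreads along legs, and
  connectedness of the edge does the rest.\<close>

lemma constant_on_model_edge:
  assumes G: "metric_graph G" and V: "model G V" and C: "C \<in> model_edges G V" and f: "rational_function G f"
    and supp: "{x \<in> points G. ord_at G f x \<noteq> 0} \<subseteq> V"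
    and x: "x \<in> C" "d \<in> half_edges G x" "slope G f d = 0" and y: "y \<in> C"
  shows "f y = f x"
proof -
  have finV: "finite V"
    using V by (simp add: model_def)
  have Cp: "C \<subseteq> points G - V"
    by (rule model_edge_props[OF G C])
  have all0: "slope G f d' = 0" if "z \<in> C" "d0 \<in> half_edges G z" "slope G f d0 = 0" "d' \<in> half_edges G z" for z d0 d'
  proof (rule ccontr)
    assume n: "slope G f d' \<noteq> 0"
    then have "half_edges G z = {d0, d'}"
      using model_edge_no_three_half_edges[OF G V C that(1,2,4)] that by fastforce
    moreover have "d0 \<noteq> d'"
      using n that(3) by auto
    ultimately have "ord_at G f z = slope G f d'"
      using that(3) by (simp add: ord_at_def)
    then show False
      using n supp Cp that(1) by auto
  qed
  \<comment> \<open>The condition on slopes is what makes \<open>W\<close> open; a level set of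
    \<open>f\<close> alone need not be.\<close>
  define W where "W = {z \<in> C. f z = f x \<and> (\<exists>d\<in>half_edges G z. slope G f d = 0)}"
  have "openin (realization G) W"
    unfolding openin_realization_iff[OF G]
  proof (intro conjI ballI)
    fix z d' assume z: "z \<in> W" and d': "d' \<in> half_edges G z"
    then obtain d0 where "d0 \<in> half_edges G z" "slope G f d0 = 0" and zC: "z \<in> C"
      unfolding W_def by blast
    then have s: "slope G f d' = 0"
      using all0[OF zC _ _ d'] by blast
    have zp: "z \<in> points G"
      using Cp zC by blast
    show "\<forall>\<^sub>F h in at_right 0. leg G d' h \<in> W"
      using leg_in_component(2)[OF G finV d' zp C zC] eventually_slope[OF G f d'] leg_slope[OF G f d']
      by eventually_elim (use z s in \<open>auto simp: W_def\<close>)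
  qed (use Cp in \<open>auto simp: W_def\<close>)
  moreover have "openin (realization G) (C - W)"
    unfolding openin_realization_iff[OF G]
  proof (intro conjI ballI)
    fix z d' assume z: "z \<in> C - W" and d': "d' \<in> half_edges G z"
    then have zp: "z \<in> points G" and zC: "z \<in> C"
      using Cp by auto
    show "\<forall>\<^sub>F h in at_right 0. leg G d' h \<in> C - W"
      using leg_in_component(2)[OF G finV d' zp C zC] eventually_slope[OF G f d'] leg_slope[OF G f d']
    proof eventually_elim
      case (elim h)
      \<comment> \<open>If the slope along \<open>d'\<close> is zero, then \<open>f z\<close>
        differs from \<open>f x\<close> and this value persists on the leg. Otherwise the nonzero
        slope persists and, by \<open>all0\<close>, excludes a zero slope there.\<close>
      show ?case
      proof (cases "slope G f d' = 0")
        case True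
        then show ?thesis
          using elim z d' by (auto simp: W_def)
      next
        case False
        then have "\<not> (\<exists>d\<in>half_edges G (leg G d' h). slope G f d = 0)"
          using elim all0 by metis
        then show ?thesis
          using elim by (auto simp: W_def)
      qed
    qed
  qed (use Cp in auto)
  moreover have "x \<in> W"
    using x by (auto simp: W_def)
  moreover have "y \<in> C - W" if "y \<notin> W"
    using y that by simp
  ultimately have "y \<in> W"
    using connectedinD[OF model_edge_props(2)[OF G C], of W "C - W"] x(1) y by (auto simp: W_def)
  then show ?thesis
    by (simp add: W_def)
qed

text \<open>Once \<open>V\<close> contains all vertices, a component of the complement is an open
  subinterval of a single edge, bounded by two consecutive parameters of points in \<open>V\<close>.
  This supplies the model for the maximum.\<close>

lemma model_if_vertices:
  fixes G :: "('v, 'e) graph"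
  assumes G: "metric_graph G" and V: "finite V" "Vert ` verts G \<subseteq> V" "V \<subseteq> points G"
  shows "model G V"
  unfolding model_def
proof (intro conjI ballI V)
  fix C assume C: "C \<in> model_edges G V"
  obtain x where xC: "x \<in> C"
    using model_edge_props(3)[OF G C] by blast
  then have xp: "x \<in> points G - V"
    using model_edge_props(1)[OF G C] by blast
  then obtain e t where xt: "x = Inner e t" and e: "e \<in> edges G" and t: "0 < t" "t < elen G e"
    using V(2) by (auto simp: points_def)
  define A where "A = {s \<in> {0..elen G e}. chart G e s \<in> V}"
  have finA: "finite A"
    unfolding A_def by (rule finite_chart_preimage[OF V(1)])
  \<comment> \<open>Both ends of the edge are in \<open>V\<close>, so \<open>t\<close> has a
    neighbour in \<open>A\<close> on either side.\<close>
  have A0: "0 \<in> A" "elen G e \<in> A"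
    using G V(2) e t by (auto simp: A_def chart_def metric_graph_def)
  have tA: "t \<notin> A"
    using xp t by (simp add: A_def xt chart_inner)
  define a where "a = Max {s \<in> A. s < t}"
  define b where "b = Min {s \<in> A. t < s}"
  have "a \<in> {s \<in> A. s < t}"
    unfolding a_def using finA A0 t by (intro Max_in) auto
  then have a: "a \<in> A" "a < t" by auto
  have "b \<in> {s \<in> A. t < s}"
    unfolding b_def using finA A0 t by (intro Min_in) auto
  then have b: "b \<in> A" "t < b" by auto
  have ab: "0 \<le> a" "b \<le> elen G e" "a < b"
    using a b by (auto simp: A_def)
  have gap: "s \<notin> A" if "a < s" "s < b" for s
  proof
    assume s: "s \<in> A"
    have "s \<le> a" if "s < t"
      unfolding a_def using finA s that by (intro Max_ge) auto
    moreover have "b \<le> s" if "t < s"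
      unfolding b_def using finA s that by (intro Min_le) auto
    ultimately show False
      using that s tA by (metis linorder_neqE_linordered_idom not_less)
  qed
  define I :: "('v, 'e) point set" where "I = Inner e ` {a<..<b}"
  have chartI: "chart G e ` {a<..<b} = I"
    unfolding I_def using ab by (intro image_cong) (auto simp: chart_inner)
  have Ip: "I \<subseteq> points G - V"
    unfolding I_def using gap ab e by (auto simp: points_def A_def chart_inner)
  have xI: "x \<in> I"
    unfolding I_def xt using a b by auto
  have conn: "connectedin (subtopology (realization G) (points G - V)) I"
  proof -
    have "connectedin (top_of_set {0..elen G e}) {a<..<b}"
      using ab by (auto simp: connectedin_subtopology)
    then show ?thesis
      using connectedin_continuous_map_image[OF continuous_map_chart[OF G e]] Ip
      by (auto simp: connectedin_subtopology chartI[symmetric])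
  qed
  \<comment> \<open>Stated for all open \<open>U\<close> because it is used twice: with
    \<open>{a<..<b}\<close> for the openness of \<open>I\<close>, and with images of open sets to
    show that the parametrisation is an open map.\<close>
  have openI: "openin (realization G) (Inner e ` U)" if U: "open U" "U \<subseteq> {a<..<b}" for U
    unfolding openin_realization_iff[OF G]
  proof (intro conjI ballI)
    show "Inner e ` U \<subseteq> points G"
      using U(2) Ip by (auto simp: I_def)
    fix z d assume z: "z \<in> Inner e ` U" and d: "d \<in> half_edges G z"
    then obtain s where s: "z = Inner e s" "s \<in> U" by blast
    then have "0 < s" "s < elen G e"
      using U(2) ab by auto
    then obtain \<sigma> where \<sigma>: "d = (e, s, \<sigma>)" "\<sigma> = 1 \<or> \<sigma> = -1"
      using d half_edges_Inner[OF e, of s] s by auto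
    obtain \<epsilon> where \<epsilon>: "\<epsilon> > 0" "ball s \<epsilon> \<subseteq> U"
      using U(1) s(2) open_contains_ball by blast
    have "\<forall>\<^sub>F h in at_right 0. h < \<epsilon>"
      unfolding eventually_at_right_field using \<epsilon> by blast
    then show "\<forall>\<^sub>F h in at_right 0. leg G d h \<in> Inner e ` U"
      using eventually_leg_Inner[OF d[unfolded \<sigma>(1)]]
    proof eventually_elim
      case (elim h)
      then have "s + \<sigma> * h \<in> ball s \<epsilon>"
        using \<sigma>(2) by (auto simp: dist_real_def)
      then show ?case
        using elim \<epsilon>(2) \<sigma>(1) by auto
    qed
  qed
  \<comment> \<open>Together with the openness of \<open>I\<close> this splits
    \<open>points G - V\<close> into two open parts, so the component of \<open>x\<close> cannot
    exceed \<open>I\<close>.\<close>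
  have openrest: "openin (realization G) (points G - V - I)"
    unfolding openin_realization_iff[OF G]
  proof (intro conjI ballI)
    fix z d assume z: "z \<in> points G - V - I" and d: "d \<in> half_edges G z"
    then obtain e' s where s: "z = Inner e' s" "e' \<in> edges G" "0 < s" "s < elen G e'"
      using V(2) by (auto simp: points_def)
    then obtain \<sigma> where \<sigma>: "d = (e', s, \<sigma>)" "\<sigma> = 1 \<or> \<sigma> = -1"
      using d half_edges_Inner[OF s(2-4)] by auto
    have "\<forall>\<^sub>F h in at_right 0. leg G d h \<notin> I"
    proof (cases "e' = e")
      case False
      show ?thesis
        using eventually_leg_Inner[OF d[unfolded \<sigma>(1)]]
        by eventually_elim (use False in \<open>auto simp: I_def \<sigma>(1)\<close>)
    next
      case True
      have "s \<notin> A"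
        using z s True by (simp add: A_def chart_inner)
      moreover have "s \<notin> {a<..<b}"
        using z s True by (auto simp: I_def)
      \<comment> \<open>\<open>a\<close> and \<open>b\<close> belong to \<open>A\<close> while
        \<open>s\<close> does not, so the inequalities are strict and leave room for a short
        leg.\<close>
      ultimately have "s < a \<or> b < s"
        using a b by (metis greaterThanLessThan_iff linorder_neqE_linordered_idom)
      then have "\<exists>\<epsilon>>0. \<forall>h. 0 < h \<and> h < \<epsilon> \<longrightarrow> s + \<sigma> * h \<notin> {a<..<b}"
      proof
        assume "s < a"
        then show ?thesis
          using \<sigma>(2) by (intro exI[of _ "a - s"]) auto
      next
        assume "b < s"
        then show ?thesis
          using \<sigma>(2) by (intro exI[of _ "s - b"]) auto
      qed
      then have "\<forall>\<^sub>F h in at_right 0. s + \<sigma> * h \<notin> {a<..<b}"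
        unfolding eventually_at_right_field by blast
      then show ?thesis
        using eventually_leg_Inner[OF d[unfolded \<sigma>(1)]]
        by eventually_elim (auto simp: I_def \<sigma>(1))
    qed
    then show "\<forall>\<^sub>F h in at_right 0. leg G d h \<in> points G - V - I"
      using eventually_leg_avoid[OF G V(1) d] by eventually_elim auto
  qed auto
  have CI: "C = I"
  proof
    show "I \<subseteq> C"
      using connected_components_of_maximal[OF C[unfolded model_edges_def] conn] xC xI
      by (auto simp: disjnt_iff)
    have oI: "openin (realization G) I"
      using openI[of "{a<..<b}"] by (simp add: I_def)
    show "C \<subseteq> I"
    proof (rule ccontr)
      assume "\<not> C \<subseteq> I"
      then have "(points G - V - I) \<inter> C \<noteq> {}"
        using model_edge_props(1)[OF G C] by blast
      moreover have "C \<subseteq> I \<union> (points G - V - I)"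
        using model_edge_props(1)[OF G C] by blast
      ultimately show False
        using connectedinD[OF model_edge_props(2)[OF G C] oI openrest] xC xI by blast
    qed
  qed
  define \<phi> where "\<phi> s = a + (b - a) * s" for s :: real
  have \<phi>: "\<phi> ` {0<..<1} = {a<..<b}"
  proof
    show "\<phi> ` {0<..<1} \<subseteq> {a<..<b}"
    proof
      fix r assume "r \<in> \<phi> ` {0<..<1}"
      then obtain s where s: "r = a + (b - a) * s" "0 < s" "s < 1"
        unfolding \<phi>_def image_iff Bex_def greaterThanLessThan_iff by blast
      then have "0 < (b - a) * s" "(b - a) * s < (b - a) * 1"
        using ab by (auto intro!: mult_strict_left_mono)
      then show "r \<in> {a<..<b}"
        using s by simp
    qed
    show "{a<..<b} \<subseteq> \<phi> ` {0<..<1}"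
    proof
      fix s assume "s \<in> {a<..<b}"
      then show "s \<in> \<phi> ` {0<..<1}"
        using ab by (intro image_eqI[of _ _ "(s - a) / (b - a)"]) (auto simp: \<phi>_def)
    qed
  qed
  have \<phi>I: "chart G e (\<phi> s) \<in> I" if "s \<in> {0<..<1}" for s
    using \<phi> that chartI by (metis imageI)
  have "homeomorphic_map (top_of_set {0<..<1}) (subtopology (realization G) I) (chart G e \<circ> \<phi>)"
  proof (rule bijective_open_imp_homeomorphic_map)
    have "continuous_map (top_of_set {0<..<1}) (top_of_set {0..elen G e}) \<phi>"
    proof -
      have "continuous_on {0<..<1} \<phi>"
        unfolding \<phi>_def by (intro continuous_intros)
      moreover have "\<phi> ` {0<..<1} \<subseteq> {0..elen G e}"
        unfolding \<phi> using ab by auto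
      ultimately show ?thesis
        by (simp add: continuous_map_in_subtopology image_subset_iff)
    qed
    from continuous_map_compose[OF this continuous_map_chart[OF G e]]
    show "continuous_map (top_of_set {0<..<1}) (subtopology (realization G) I) (chart G e \<circ> \<phi>)"
      using \<phi>I by (simp add: continuous_map_in_subtopology image_subset_iff Pi_iff)
    show "open_map (top_of_set {0<..<1}) (subtopology (realization G) I) (chart G e \<circ> \<phi>)"
      unfolding open_map_def
    proof (intro allI impI)
      fix U :: "real set" assume U: "openin (top_of_set {0<..<1}) U"
      then have "open U" and U01: "U \<subseteq> {0<..<1}"
        using openin_open_eq[OF open_greaterThanLessThan[of 0 "1::real"]] by blast+
      have "\<phi> ` U = (+) a ` (\<lambda>s. (b - a) *\<^sub>R s) ` U"
        by (auto simp: \<phi>_def image_image)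
      then have "open (\<phi> ` U)"
        using \<open>open U\<close> ab by (metis diff_gt_0_iff_gt less_irrefl open_scaling open_translation)
      moreover have sub: "\<phi> ` U \<subseteq> {a<..<b}"
        using \<phi> U01 by blast
      ultimately have "openin (realization G) (Inner e ` \<phi> ` U)"
        by (rule openI)
      moreover have "(chart G e \<circ> \<phi>) ` U = Inner e ` \<phi> ` U"
        unfolding image_comp[symmetric] using sub ab
        by (intro image_cong) (auto simp: chart_inner subset_iff)
      ultimately show "openin (subtopology (realization G) I) ((chart G e \<circ> \<phi>) ` U)"
        using sub unfolding openin_subtopology I_def by (metis image_mono inf.absorb1)
    qed
    show "(chart G e \<circ> \<phi>) ` topspace (top_of_set {0<..<1}) = topspace (subtopology (realization G) I)"
    proof -
      have "(chart G e \<circ> \<phi>) ` {0<..<1} = I"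
        by (metis \<phi> chartI image_comp)
      moreover have "points G \<inter> I = I"
        using Ip by blast
      ultimately show ?thesis
        by (simp add: topspace_realization[OF G])
    qed
    show "inj_on (chart G e \<circ> \<phi>) (topspace (top_of_set {0<..<1}))"
    proof (rule comp_inj_on)
      show "inj_on \<phi> (topspace (top_of_set {0<..<1}))"
        using ab by (auto simp: inj_on_def \<phi>_def)
      show "inj_on (chart G e) (\<phi> ` topspace (top_of_set {0<..<1}))"
        using \<phi> ab by (auto simp: inj_on_def chart_inner)
    qed
  qed
  then show "subtopology (realization G) C homeomorphic_space top_of_set {0<..<1::real}"
    unfolding CI by (metis homeomorphic_map_imp_homeomorphic_space homeomorphic_space_sym)
qed

subsection \<open>Realizability\<close>

lemma compactin_realization:
  assumes G: "metric_graph G"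
  shows "compactin (realization G) (points G)"
proof -
  \<comment> \<open>The vertices are listed separately because a vertex without edges lies in no
    closed edge.\<close>
  let ?F = "insert (Vert ` verts G) ((\<lambda>e. chart G e ` {0..elen G e}) ` edges G)"
  have "compactin (realization G) S" if S: "S \<in> ?F" for S
  proof -
    consider "S = Vert ` verts G" | e where "e \<in> edges G" "S = chart G e ` {0..elen G e}"
      using S by blast
    then show ?thesis
    proof cases
      case 1
      then show ?thesis
        using G by (intro finite_imp_compactin)
          (auto simp: topspace_realization[OF G] points_def metric_graph_def)
    next
      case 2
      have "compactin (top_of_set {0..elen G e}) {0..elen G e}"
        by (simp add: compactin_subtopology)
      then show ?thesis
        unfolding 2(2) by (rule image_compactin[OF _ continuous_map_chart[OF G 2(1)]])
    qed
  qed
  then have "compactin (realization G) (\<Union>?F)"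
    using G by (intro compactin_Union) (auto simp: metric_graph_def)
  moreover have "\<Union>?F = points G"
  proof
    have "chart G e ` {0..elen G e} \<subseteq> points G" if "e \<in> edges G" for e
      using chart_in_points[OF G that] by auto
    moreover have "Vert ` verts G \<subseteq> points G"
      by (auto simp: points_def)
    ultimately show "\<Union>?F \<subseteq> points G"
      by blast
    show "points G \<subseteq> \<Union>?F"
    proof
      fix x assume x: "x \<in> points G"
      show "x \<in> \<Union>?F"
      proof (cases x)
        case (Vert v)
        then show ?thesis
          using x by (auto simp: points_def)
      next
        case (Inner e t)
        then have "e \<in> edges G" "0 < t" "t < elen G e"
          using x by (auto simp: points_def)
        moreover from this have "x \<in> chart G e ` {0..elen G e}"
          by (intro image_eqI[of _ _ t]) (auto simp: Inner chart_inner)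
        ultimately show ?thesis
          by blast
      qed
    qed
  qed
  ultimately show ?thesis
    by simp
qed

text \<open>Maximum principle: the set where the difference attains its maximum is open and closed.\<close>

lemma rational_function_unique:
  assumes G: "metric_graph G" and conn: "connected_space (realization G)"
    and f: "rational_function G f" and g: "rational_function G g"
    and eq: "K_plus_div G f = K_plus_div G g"
  shows "\<exists>c. \<forall>x\<in>points G. f x = c + g x"
proof -
  define u where "u x = f x - g x" for x
  have contu: "continuous_map (realization G) euclideanreal u"
    unfolding u_def using f g by (intro continuous_map_diff) (auto simp: rational_function_def)
  have "compact (u ` points G)"
    using image_compactin[OF compactin_realization[OF G] contu] by simp
  moreover have "u ` points G \<noteq> {}"
    using G by (auto simp: metric_graph_def points_def)
  ultimately obtain x0 where x0: "x0 \<in> points G" "\<And>x. x \<in> points G \<Longrightarrow> u x \<le> u x0"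
    using compact_attains_sup[of "u ` points G"] by auto
  \<comment> \<open>\<open>g\<close> is shifted until it touches \<open>f\<close> from above. At a
    contact point the slopes of \<open>f\<close> are at most those of \<open>g'\<close> while their
    sums agree, so they agree one by one.\<close>
  define g' where "g' x = u x0 + g x" for x
  have g': "rational_function G g'"
    unfolding g'_def by (rule rational_function_add_const[OF g])
  have le: "f x \<le> g' x" if "x \<in> points G" for x
    using x0(2)[OF that] by (simp add: u_def g'_def)
  define W where "W = {x \<in> points G. f x = g' x}"
  have "openin (realization G) W"
    unfolding openin_realization_iff[OF G]
  proof (intro conjI ballI)
    fix x d assume x: "x \<in> W" and d: "d \<in> half_edges G x"
    then have xp: "x \<in> points G" and fx: "f x = g' x"
      by (auto simp: W_def)
    have "ord_at G f x = ord_at G g x"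
      using fun_cong[OF eq, of x] xp by (simp add: K_plus_div_def div_of_def)
    also have "\<dots> = ord_at G g' x"
      by (rule ord_at_add_const[OF G g _ xp, symmetric]) (simp add: g'_def)
    finally have "(\<Sum>d\<in>half_edges G x. slope G f d) = (\<Sum>d\<in>half_edges G x. slope G g' d)"
      by (simp add: ord_at_def)
    moreover have "slope G f d' \<le> slope G g' d'" if d': "d' \<in> half_edges G x" for d'
    proof (rule slope_mono[OF G f g' d' _ fx])
      show "\<forall>\<^sub>F s in at_right 0. f (leg G d' s) \<le> g' (leg G d' s)"
        using eventually_leg_avoid[OF G finite.emptyI d'] by eventually_elim (use le in auto)
    qed
    ultimately have se: "slope G f d = slope G g' d"
      using sum_mono_inv[OF _ _ d finite_half_edges[OF G]] by blast
    show "\<forall>\<^sub>F h in at_right 0. leg G d h \<in> W"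
      using eventually_leg_avoid[OF G finite.emptyI d] eventually_slope[OF G f d] eventually_slope[OF G g' d]
      by eventually_elim (use fx se in \<open>simp add: W_def\<close>)
  qed (auto simp: W_def)
  moreover have "openin (realization G) {x \<in> topspace (realization G). u x \<in> - {u x0}}"
    by (rule openin_continuous_map_preimage[OF contu]) (simp add: open_Compl)
  then have "openin (realization G) (points G - W)"
    by (rule back_subst[of "openin _"]) (auto simp: topspace_realization[OF G] W_def u_def g'_def)
  moreover have "x0 \<in> W"
    using x0(1) by (simp add: W_def g'_def u_def)
  moreover have "W \<subseteq> points G"
    by (auto simp: W_def)
  ultimately have "points G - W = {}"
    using conn unfolding connected_space_eq topspace_realization[OF G]
    by (metis Diff_disjoint Un_Diff_cancel empty_iff sup.absorb2)
  then show ?thesis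
    by (intro exI[of _ "u x0"]) (auto simp: W_def g'_def)
qed

text \<open>Passing from \<open>h\<close> to \<open>f\<close> lowers all slopes at \<open>v\<close>:
  the sum of the positive ones does not grow, and the dominating negative slope remains at least as
  large in absolute value. So \<open>f\<close> can fail to be inconvenient at \<open>v\<close> only
  through a zero slope.\<close>

lemma cycle_at_inconvenient:
  assumes G: "metric_graph G" and f: "rational_function G f" and h: "rational_function G h"
    and le: "\<And>x. x \<in> points G \<Longrightarrow> f x \<le> h x" and v: "v \<in> points G" "f v = h v" "inconvenient G h v"
    and V: "model G V" "{x \<in> points G. ord_at G f x \<noteq> 0} \<subseteq> V" "realizability_criterion G V f"
  shows "\<exists>Z. simple_cycle G Z \<and> v \<in> Z \<and> (\<forall>z\<in>Z. h v \<le> h z)"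
proof -
  have "\<exists>Z. simple_cycle G Z \<and> v \<in> Z \<and> (\<forall>z\<in>Z. f v \<le> f z)"
  proof (cases "inconvenient G f v")
    case True
    then have "v \<in> V"
      using inconvenient_ord_neg[OF G True] V(2) v(1) by auto
    then show ?thesis
      using V(3) True unfolding realizability_criterion_def by blast
  next
    case False
    let ?H = "half_edges G v"
    have sle: "slope G f d \<le> slope G h d" if d: "d \<in> ?H" for d
    proof (rule slope_mono[OF G f h d _ v(2)])
      show "\<forall>\<^sub>F s in at_right 0. f (leg G d s) \<le> h (leg G d s)"
        using eventually_leg_avoid[OF G finite.emptyI d] by eventually_elim (use le in auto)
    qed
    obtain d where d: "d \<in> ?H" "slope G h d < 0"
        "(\<Sum>d' | d' \<in> ?H \<and> slope G h d' > 0. slope G h d') < - slope G h d"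
      using v(3) unfolding inconvenient_def by blast
    have "(\<Sum>d' | d' \<in> ?H \<and> slope G f d' > 0. slope G f d')
        \<le> (\<Sum>d' | d' \<in> ?H \<and> slope G f d' > 0. slope G h d')"
      using sle by (intro sum_mono) auto
    also have "\<dots> \<le> (\<Sum>d' | d' \<in> ?H \<and> slope G h d' > 0. slope G h d')"
      using sle finite_half_edges[OF G, of v] by (intro sum_mono2) (auto intro: less_le_trans)
    finally have "(\<Sum>d' | d' \<in> ?H \<and> slope G f d' > 0. slope G f d') < - slope G f d"
      using d sle[OF d(1)] by linarith
    moreover have "slope G f d < 0"
      using d sle[OF d(1)] by linarith
    ultimately obtain d0 where d0: "d0 \<in> ?H" "slope G f d0 = 0"
      using False d(1) unfolding inconvenient_def by blast
    have finV: "finite V"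
      using V(1) by (simp add: model_def)
    obtain C where C: "C \<in> model_edges G V" "\<forall>\<^sub>F s in at_right 0. leg G d0 s \<in> C"
      using leg_in_component(1)[OF G finV d0(1) v(1)] by blast
    have "\<forall>\<^sub>F s in at_right 0. leg G d0 s \<in> C \<and> f (leg G d0 s) = f v \<and>
        (\<exists>d'\<in>half_edges G (leg G d0 s). slope G f d' = 0)"
      using C(2) eventually_slope[OF G f d0(1)] leg_slope[OF G f d0(1)]
      by eventually_elim (simp add: d0(2))
    \<comment> \<open>\<open>v\<close> may belong to \<open>V\<close>, so constancy is derived from
      a point \<open>y\<close> of the leg inside \<open>C\<close>, where the zero slope and the
      value \<open>f v\<close> persist.\<close>
    then obtain y d' where y: "y \<in> C" "f y = f v" "d' \<in> half_edges G y" "slope G f d' = 0"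
      using eventually_happens'[OF trivial_limit_at_right_real] by blast
    have const: "f z = f v" if "z \<in> C" for z
      using constant_on_model_edge[OF G V(1) C(1) f V(2) y(1,3,4) that] y(2) by simp
    then have "horizontal f C"
      unfolding horizontal_def constant_on_def by blast
    then obtain Z where Z: "simple_cycle G Z" "C \<subseteq> Z" "\<forall>z\<in>Z. \<forall>x\<in>C. f x \<le> f z"
      using V(3) C(1) unfolding realizability_criterion_def by blast
    have "\<forall>\<^sub>F s in at_right 0. leg G d0 s \<in> Z"
      using C(2) by eventually_elim (use Z(2) in auto)
    then have "v \<in> Z"
      by (rule simple_cycle_closed[OF G Z(1) v(1) d0(1)])
    then show ?thesis
      using Z y(1,2) by metis
  qed
  then show ?thesis
    using le v(2) simple_cycle_subset_points[OF G] by (metis order_trans subsetD)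
qed

text \<open>The two functions are tested on different models. Since \<open>V'\<close> refines
  \<open>V\<close>, the edge \<open>C\<close> lies in an edge \<open>C'\<close> of \<open>V\<close>,
  and the criterion for \<open>f\<close> is applied to \<open>C'\<close>. Contact at the single
  point \<open>p\<close> suffices to make \<open>f\<close> constant on all of
  \<open>C'\<close>.\<close>

lemma cycle_at_horizontal:
  assumes G: "metric_graph G" and f: "rational_function G f" and h: "rational_function G h"
    and le: "\<And>x. x \<in> points G \<Longrightarrow> f x \<le> h x"
    and V: "model G V" "{x \<in> points G. ord_at G f x \<noteq> 0} \<subseteq> V" "realizability_criterion G V f"
    and V': "finite V'" "V \<subseteq> V'" "Vert ` verts G \<subseteq> V'"
    and C: "C \<in> model_edges G V'" "\<And>x. x \<in> C \<Longrightarrow> h x = h p" and p: "p \<in> C" "f p = h p"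
  shows "\<exists>Z. simple_cycle G Z \<and> C \<subseteq> Z \<and> (\<forall>z\<in>Z. \<forall>x\<in>C. h x \<le> h z)"
proof -
  have pp: "p \<in> points G - V'" and CV': "C \<subseteq> points G - V'"
    using model_edge_props(1)[OF G C(1)] p(1) by auto
  \<comment> \<open>As \<open>V'\<close> contains all vertices, \<open>p\<close> is inside an edge
    of \<open>G\<close>, which provides a half-edge at \<open>p\<close> from which constancy can be
    started.\<close>
  then obtain e t where et: "p = Inner e t" "e \<in> edges G" "0 < t" "t < elen G e"
    using V'(3) by (auto simp: points_def)
  have h0: "slope G h d = 0" and fh: "slope G f d \<le> slope G h d" if d: "d \<in> half_edges G p" for d
  proof -
    have "\<forall>\<^sub>F s in at_right 0. h (leg G d s) = h p + of_int 0 * s"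
      using leg_in_component(2)[OF G V'(1) d _ C(1) p(1)] pp C(2) by (auto elim: eventually_mono)
    then show "slope G h d = 0"
      by (rule slope_eqI[OF d])
    have "\<forall>\<^sub>F s in at_right 0. f (leg G d s) \<le> h (leg G d s)"
      using eventually_leg_avoid[OF G finite.emptyI d] by eventually_elim (use le in auto)
    then show "slope G f d \<le> slope G h d"
      by (rule slope_mono[OF G f h d _ p(2)])
  qed
  have "ord_at G f p = 0"
    using pp V(2) V'(2) by auto
  then have "(\<Sum>d\<in>half_edges G p. slope G f d) = (\<Sum>d\<in>half_edges G p. slope G h d)"
    using h0 by (simp add: ord_at_def)
  moreover have d: "(e, t, 1) \<in> half_edges G p"
    using half_edges_Inner[OF et(2-4)] et(1) by simp
  ultimately have f0: "slope G f (e, t, 1) = 0"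
    using sum_mono_inv[of "slope G f" _ "slope G h", OF _ fh d finite_half_edges[OF G]] h0[OF d] by simp
  have "connectedin (subtopology (realization G) (points G - V)) C"
    using model_edge_props(2)[OF G C(1)] CV' V'(2) by (auto simp: connectedin_subtopology)
  moreover have "subtopology (realization G) (points G - V) \<noteq> trivial_topology"
    using pp V'(2) topspace_realization[OF G]
    by (metis Diff_iff IntI empty_iff subsetD topspace_discrete_topology topspace_subtopology)
  ultimately obtain C' where C': "C' \<in> model_edges G V" "C \<subseteq> C'"
    unfolding model_edges_def using exists_connected_component_of_superset by blast
  have const: "f z = f p" if "z \<in> C'" for z
    using constant_on_model_edge[OF G V(1) C'(1) f V(2) _ d f0 that] C'(2) p(1) by blast
  then have "horizontal f C'"
    unfolding horizontal_def constant_on_def by blast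
  then obtain Z where Z: "simple_cycle G Z" "C' \<subseteq> Z" "\<forall>z\<in>Z. \<forall>x\<in>C'. f x \<le> f z"
    using V(3) C'(1) unfolding realizability_criterion_def by blast
  have "h x \<le> h z" if "z \<in> Z" "x \<in> C" for x z
  proof -
    have "h x = f p"
      using C(2)[OF that(2)] p(2) by simp
    also have "\<dots> \<le> f z"
      using Z(3) that(1) C'(2) p(1) by blast
    also have "\<dots> \<le> h z"
      using le simple_cycle_subset_points[OF G Z(1)] that(1) by blast
    finally show ?thesis .
  qed
  then show ?thesis
    using Z(1,2) C'(2) by blast
qed

text \<open>The condition in \<open>realizable\<close> for one fixed function instead of some
  function with the given divisor, because the tropical operations act on functions.\<close>

definition realizable_function :: "('v, 'e) graph \<Rightarrow> (('v, 'e) point \<Rightarrow> real) \<Rightarrow> bool" where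
  "realizable_function G f \<longleftrightarrow> f \<in> canonical_functions G \<and>
     (\<exists>V. model G V \<and> {x \<in> points G. ord_at G f x \<noteq> 0} \<subseteq> V \<and> realizability_criterion G V f)"

text \<open>Connectedness enters here: the function witnessing realizability differs from
  \<open>f\<close> by a constant, and the criterion survives adding a constant, with the same
  model.\<close>

lemma realizable_divisors_iff:
  assumes G: "metric_graph G" and conn: "connected_space (realization G)"
    and f: "f \<in> canonical_functions G"
  shows "K_plus_div G f \<in> realizable_divisors G \<longleftrightarrow> realizable_function G f"
proof
  assume "realizable_function G f"
  then show "K_plus_div G f \<in> realizable_divisors G"
    using f unfolding realizable_divisors_def realizable_def realizable_function_def canonical_system_def
    by blast
next
  assume "K_plus_div G f \<in> realizable_divisors G"
  then obtain g V where g: "g \<in> canonical_functions G" "K_plus_div G f = K_plus_div G g"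
    and V: "model G V" "{x \<in> points G. ord_at G g x \<noteq> 0} \<subseteq> V" "realizability_criterion G V g"
    unfolding realizable_divisors_def realizable_def by blast
  have rat: "rational_function G f" "rational_function G g"
    using f g(1) by (auto simp: canonical_functions_def)
  obtain c where c: "\<And>x. x \<in> points G \<Longrightarrow> f x = c + g x"
    using rational_function_unique[OF G conn rat g(2)] by blast
  have "realizability_criterion G V f"
    using realizability_criterion_add_const[OF G rat(2) c _ V(3)] V(1) by (auto simp: model_def)
  moreover have "{x \<in> points G. ord_at G f x \<noteq> 0} \<subseteq> V"
    using V(2) ord_at_add_const[OF G rat(2) c] by auto
  ultimately show "realizable_function G f"
    unfolding realizable_function_def using f V(1) by blast
qed

lemma realizable_function_max:
  assumes G: "metric_graph G" and f: "realizable_function G f" and g: "realizable_function G g"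
  shows "realizable_function G (\<lambda>x. max (f x) (g x))"
proof -
  define h where "h x = max (f x) (g x)" for x
  obtain V where V: "model G V" "{x \<in> points G. ord_at G f x \<noteq> 0} \<subseteq> V" "realizability_criterion G V f"
    using f unfolding realizable_function_def by blast
  obtain W where W: "model G W" "{x \<in> points G. ord_at G g x \<noteq> 0} \<subseteq> W" "realizability_criterion G W g"
    using g unfolding realizable_function_def by blast
  have rf: "rational_function G f" and rg: "rational_function G g"
    and ef: "effective G (K_plus_div G f)" and eg: "effective G (K_plus_div G g)"
    using f g by (auto simp: realizable_function_def canonical_functions_def)
  have rh: "rational_function G h"
    unfolding h_def by (rule rational_function_max[OF rf rg])
  have le: "f x \<le> h x" "g x \<le> h x" for x
    by (auto simp: h_def)
  have eqs: "f x = h x \<or> g x = h x" for x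
    by (auto simp: h_def max_def)
  have "0 \<le> K_plus_div G h x" for x
  proof (cases "x \<in> points G")
    case True
    have "ord_at G f x \<le> ord_at G h x \<or> ord_at G g x \<le> ord_at G h x"
      using eqs[of x] ord_at_mono[OF G rf rh le(1)] ord_at_mono[OF G rg rh le(2)] by blast
    moreover have "0 \<le> K_plus_div G f x" "0 \<le> K_plus_div G g x"
      using ef eg by (auto simp: effective_def)
    ultimately show ?thesis
      using True by (auto simp: K_plus_div_def div_of_def)
  qed (simp add: K_plus_div_def div_of_def canonical_divisor_def)
  then have ch: "h \<in> canonical_functions G"
    using rh divisor_K_plus_div[OF G rh] by (simp add: canonical_functions_def effective_def)
  \<comment> \<open>\<open>V\<close> and \<open>W\<close> make each edge of \<open>U\<close> lie in
    an edge of either old model, the vertices of \<open>G\<close> make \<open>U\<close> a model, and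
    the support of \<open>h\<close> is demanded by \<open>realizable_function\<close>.\<close>
  define U where "U = V \<union> W \<union> Vert ` verts G \<union> {x \<in> points G. ord_at G h x \<noteq> 0}"
  have finU: "finite U"
    using V(1) W(1) G finite_ord_at[OF G rh] by (auto simp: U_def model_def metric_graph_def)
  have Up: "U \<subseteq> points G"
    using V(1) W(1) by (auto simp: U_def model_def points_def)
  have "model G U"
    by (rule model_if_vertices[OF G finU _ Up]) (auto simp: U_def)
  moreover have "realizability_criterion G U h"
    unfolding realizability_criterion_def
  proof (intro conjI ballI impI)
    fix v assume v: "v \<in> U" "inconvenient G h v"
    show "\<exists>Z. simple_cycle G Z \<and> v \<in> Z \<and> (\<forall>z\<in>Z. h v \<le> h z)"
      using eqs[of v]
    proof
      assume "f v = h v"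
      then show ?thesis
        using cycle_at_inconvenient[OF G rf rh le(1) _ _ v(2) V] v(1) Up by blast
    next
      assume "g v = h v"
      then show ?thesis
        using cycle_at_inconvenient[OF G rg rh le(2) _ _ v(2) W] v(1) Up by blast
    qed
  next
    fix C assume C: "C \<in> model_edges G U" "horizontal h C"
    obtain p where p: "p \<in> C"
      using model_edge_props(3)[OF G C(1)] by blast
    then have const: "h x = h p" if "x \<in> C" for x
      using C(2) that unfolding horizontal_def constant_on_def by metis
    have sub: "V \<subseteq> U" "W \<subseteq> U" "Vert ` verts G \<subseteq> U"
      by (auto simp: U_def)
    show "\<exists>Z. simple_cycle G Z \<and> C \<subseteq> Z \<and> (\<forall>z\<in>Z. \<forall>x\<in>C. h x \<le> h z)"
      using eqs[of p]
    proof
      assume *: "f p = h p"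
      show ?thesis
        by (rule cycle_at_horizontal[OF G rf rh le(1) V finU sub(1,3) C(1) const p *])
    next
      assume *: "g p = h p"
      show ?thesis
        by (rule cycle_at_horizontal[OF G rg rh le(2) W finU sub(2,3) C(1) const p *])
    qed
  qed
  moreover have "{x \<in> points G. ord_at G h x \<noteq> 0} \<subseteq> U"
    by (auto simp: U_def)
  ultimately have "realizable_function G h"
    unfolding realizable_function_def using ch by blast
  then show ?thesis
    by (simp add: h_def[abs_def])
qed

section \<open>The tropical submodule of realizable functions\<close>

theorem proposition3p21:
  fixes G :: "('v, 'e) graph"
  assumes "metric_graph G"
    and "connected_space (realization G)"
  shows "tropically_convex G (realizable_divisors G)"
proof -
  note G = assms(1)
  let ?F = "{f \<in> canonical_functions G. K_plus_div G f \<in> realizable_divisors G}"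
  let ?M = "insert trop_bot (lift_fun ` ?F)"
  have F: "?F = {f. realizable_function G f}"
    using realizable_divisors_iff[OF assms] by (auto simp: realizable_function_def)
  have "trop_add f g \<in> ?M" if fg: "f \<in> ?M" "g \<in> ?M" for f g
  proof -
    consider "f = trop_bot" | "g = trop_bot"
      | f' g' where "f = lift_fun f'" "g = lift_fun g'" "f' \<in> ?F" "g' \<in> ?F"
      using fg by blast
    then show ?thesis
    proof cases
      case 1
      then show ?thesis
        using fg(2) by (simp add: trop_add_def trop_bot_def)
    next
      case 2
      then show ?thesis
        using fg(1) by (simp add: trop_add_def trop_bot_def)
    next
      case 3
      then have "(\<lambda>x. max (f' x) (g' x)) \<in> ?F"
        using realizable_function_max[OF G] unfolding F by blast
      moreover have "trop_add f g = lift_fun (\<lambda>x. max (f' x) (g' x))"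
        by (simp add: 3(1,2) trop_add_def lift_fun_def fun_eq_iff max_def)
      ultimately show ?thesis
        by blast
    qed
  qed
  moreover have "trop_scale c f \<in> ?M" if c: "c \<noteq> \<infinity>" and f: "f \<in> ?M" for c f
  proof -
    consider "c = -\<infinity>" | "f = trop_bot" | r f' where "c = ereal r" "f = lift_fun f'" "f' \<in> ?F"
      using c f by (cases c) auto
    then show ?thesis
    proof cases
      case 1
      then have "trop_scale c f = trop_bot"
        using f by (auto simp: trop_scale_def trop_bot_def lift_fun_def)
      then show ?thesis
        by simp
    next
      case 2
      then have "trop_scale c f = trop_bot"
        using c by (cases c) (auto simp: trop_scale_def trop_bot_def)
      then show ?thesis
        by simp
    next
      case 3
      have rat: "rational_function G f'"
        using 3(3) by (simp add: canonical_functions_def)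
      have "K_plus_div G (\<lambda>x. r + f' x) = K_plus_div G f'"
        by (rule K_plus_div_add_const[OF G rat]) simp
      then have "(\<lambda>x. r + f' x) \<in> ?F"
        using 3(3) rational_function_add_const[OF rat] by (simp add: canonical_functions_def)
      moreover have "trop_scale c f = lift_fun (\<lambda>x. r + f' x)"
        by (simp add: 3(1,2) trop_scale_def lift_fun_def)
      ultimately show ?thesis
        by blast
    qed
  qed
  moreover have "?M \<subseteq> RK G"
    unfolding RK_def by blast
  moreover have "realizable_divisors G \<subseteq> canonical_system G"
    by (auto simp: realizable_divisors_def)
  ultimately show ?thesis
    unfolding tropically_convex_def trop_submodule_def by blast
qed

end
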